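(* Let $G$ be a finite simple graph and let $\overline{G}$ denote its complement. The following three properties are equivalent: (i) $G$ is (wheel, antiwheel)-free, i.e., no induced subgraph of $G$ is isomorphic to a wheel or to an antiwheel; (ii) $G$ has no induced subgraph on at most seven vertices that is isomorphic to a wheel or to an antiwheel; (iii) $G$ or $\overline{G}$ is either a $5$-hole (i.e., isomorphic to the cycle $C_5$), a $6$-hole (i.e., isomorphic to $C_6$), a split graph, or a member of $\mathcal{A}\cup\mathcal{B}\cup\mathcal{C}$.
   Context: All graphs are finite and simple. A hole is a chordless (induced) cycle of length at least $4$; a $k$-hole is a hole on $k$ vertices. A wheel is a graph consisting of a chordless cycle of length at least $4$ together with one additional vertex that has at least three neighbors on the cycle. An antiwheel is the complement of a wheel. A graph is $\mathcal{F}$-free if it has no induced subgraph isomorphic to a member of $\mathcal{F}$. A set $S$ is complete (resp. anticomplete) to a set $T$ if every vertex of $S$ is adjacent (resp. non-adjacent) to every vertex of $T$. A graph is split if its vertex set can be partitioned into a stable set and a clique. $P_5$ denotes the path on $5$ vertices. Class $\mathcal{A}$: $G\in\mathcal{A}$ if $V(G)$ can be partitioned into two sets $\{a,b,c,d,e\}$ (five distinct vertices) and $X$ such that: $\{a,b,c,d\}$ induces a hole with edges $ab,bc,cd,da$; $X$ is non-empty, is a clique, is complete to $\{c,d\}$ and anticomplete to $\{a,b\}$; $e$ is complete to $X$, anticomplete to $\{a,b\}$, and has at most one neighbor in $\{c,d\}$. Class $\mathcal{B}$: $G\in\mathcal{B}$ if $V(G)$ can be partitioned into four stable sets $X,Y,Z,W$,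 with two special vertices $x\in X$ and $y\in Y$, such that: $|X|\ge 2$, $|Y|\ge 2$, and $X\cup Y$ induces a connected $P_5$-free bipartite graph; $W$ is anticomplete to $X\cup Y\cup Z$; $x$ is complete to $Y$ and $y$ is complete to $X$; $Z$ is complete to $\{x,y\}$ and anticomplete to $(X\cup Y)\setminus\{x,y\}$. Class $\mathcal{C}$: $G\in\mathcal{C}$ if $V(G)$ can be partitioned into two cliques $X$ and $Y$, each of size at least $2$, such that the set of edges between $X$ and $Y$ forms a matching of size exactly $2$. *)

theory Defs
  imports "Graph_Theory.Digraph_Component" "Graph_Theory.Digraph_Isomorphism"
begin

text \<open>
  A finite simple graph is a digraph satisfying the locale predicate \<^const>\<open>graph\<close> (finite,
  loop-free, no parallel arcs, symmetric); an undirected edge is a pair of opposite arcs.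
\<close>

definition complement :: "('a,'b) pre_digraph \<Rightarrow> ('a, 'a \<times> 'a) pre_digraph" where
  "complement G = with_proj \<lparr> pverts = verts G,
     parcs = {(u,v). u \<in> verts G \<and> v \<in> verts G \<and> u \<noteq> v \<and> \<not> u \<rightarrow>\<^bsub>G\<^esub> v} \<rparr>"

definition cycle_graph :: "nat \<Rightarrow> nat pair_pre_digraph" where
  "cycle_graph n = \<lparr> pverts = {..<n},
     parcs = {(i,j). i < n \<and> j < n \<and> (j = Suc i mod n \<or> i = Suc j mod n)} \<rparr>"

definition path_graph :: "nat \<Rightarrow> nat pair_pre_digraph" where
  "path_graph n = \<lparr> pverts = {..<n},
     parcs = {(i,j). i < n \<and> j < n \<and> (j = Suc i \<or> i = Suc j)} \<rparr>"

text \<open>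
  \<open>is_hole k G\<close>: the whole graph \<open>G\<close> is a hole on \<open>k\<close> vertices.
\<close>

definition is_hole :: "nat \<Rightarrow> ('a,'b) pre_digraph \<Rightarrow> bool" where
  "is_hole k G \<longleftrightarrow> graph G \<and> 4 \<le> k \<and> digraph_iso G (with_proj (cycle_graph k))"

definition is_wheel :: "('a,'b) pre_digraph \<Rightarrow> bool" where
  "is_wheel G \<longleftrightarrow> graph G \<and>
     (\<exists>h \<in> verts G. (\<exists>k. is_hole k (G \<restriction> (verts G - {h}))) \<and>
        3 \<le> card {v \<in> verts G - {h}. h \<rightarrow>\<^bsub>G\<^esub> v})"

definition is_antiwheel :: "('a,'b) pre_digraph \<Rightarrow> bool" where
  "is_antiwheel G \<longleftrightarrow> graph G \<and> is_wheel (complement G)"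

text \<open>
  A family of forbidden graphs is given as an isomorphism-invariant predicate \<open>F\<close>, so that
  ``isomorphic to a member of the family'' is just \<open>F H\<close>.
\<close>

definition free_of :: "(('a,'b) pre_digraph \<Rightarrow> bool) \<Rightarrow> ('a,'b) pre_digraph \<Rightarrow> bool" where
  "free_of F G \<longleftrightarrow> \<not> (\<exists>H. induced_subgraph H G \<and> F H)"

definition complete_to :: "('a,'b) pre_digraph \<Rightarrow> 'a set \<Rightarrow> 'a set \<Rightarrow> bool" where
  "complete_to G S T \<longleftrightarrow> (\<forall>s \<in> S. \<forall>t \<in> T. s \<rightarrow>\<^bsub>G\<^esub> t)"

definition anticomplete_to :: "('a,'b) pre_digraph \<Rightarrow> 'a set \<Rightarrow> 'a set \<Rightarrow> bool" where
  "anticomplete_to G S T \<longleftrightarrow> (\<forall>s \<in> S. \<forall>t \<in> T. \<not> s \<rightarrow>\<^bsub>G\<^esub> t)"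

definition clique :: "('a,'b) pre_digraph \<Rightarrow> 'a set \<Rightarrow> bool" where
  "clique G S \<longleftrightarrow> S \<subseteq> verts G \<and> (\<forall>u \<in> S. \<forall>v \<in> S. u \<noteq> v \<longrightarrow> u \<rightarrow>\<^bsub>G\<^esub> v)"

definition stable :: "('a,'b) pre_digraph \<Rightarrow> 'a set \<Rightarrow> bool" where
  "stable G S \<longleftrightarrow> S \<subseteq> verts G \<and> (\<forall>u \<in> S. \<forall>v \<in> S. \<not> u \<rightarrow>\<^bsub>G\<^esub> v)"

definition split_graph :: "('a,'b) pre_digraph \<Rightarrow> bool" where
  "split_graph G \<longleftrightarrow> graph G \<and>
     (\<exists>S K. verts G = S \<union> K \<and> S \<inter> K = {} \<and> stable G S \<and> clique G K)"

definition bipartite :: "('a,'b) pre_digraph \<Rightarrow> bool" where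
  "bipartite G \<longleftrightarrow> graph G \<and>
     (\<exists>S T. verts G = S \<union> T \<and> S \<inter> T = {} \<and> stable G S \<and> stable G T)"

definition class_A :: "('a,'b) pre_digraph \<Rightarrow> bool" where
  "class_A G \<longleftrightarrow> graph G \<and>
     (\<exists>a b c d e X.
        distinct [a, b, c, d, e] \<and>
        verts G = {a, b, c, d, e} \<union> X \<and> {a, b, c, d, e} \<inter> X = {} \<and>
        arcs_ends (G \<restriction> {a, b, c, d}) = symcl {(a,b), (b,c), (c,d), (d,a)} \<and>
        X \<noteq> {} \<and> clique G X \<and> complete_to G X {c, d} \<and> anticomplete_to G X {a, b} \<and>
        complete_to G {e} X \<and> anticomplete_to G {e} {a, b} \<and>
        card {v \<in> {c, d}. e \<rightarrow>\<^bsub>G\<^esub> v} \<le> 1)"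

definition class_B :: "('a,'b) pre_digraph \<Rightarrow> bool" where
  "class_B G \<longleftrightarrow> graph G \<and>
     (\<exists>X Y Z W x y.
        verts G = X \<union> Y \<union> Z \<union> W \<and>
        X \<inter> Y = {} \<and> X \<inter> Z = {} \<and> X \<inter> W = {} \<and> Y \<inter> Z = {} \<and> Y \<inter> W = {} \<and> Z \<inter> W = {} \<and>
        stable G X \<and> stable G Y \<and> stable G Z \<and> stable G W \<and>
        x \<in> X \<and> y \<in> Y \<and> 2 \<le> card X \<and> 2 \<le> card Y \<and>
        connected (G \<restriction> (X \<union> Y)) \<and> bipartite (G \<restriction> (X \<union> Y)) \<and>
        free_of (\<lambda>H. digraph_iso H (with_proj (path_graph 5))) (G \<restriction> (X \<union> Y)) \<and>
        anticomplete_to G W (X \<union> Y \<union> Z) \<and>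
        complete_to G {x} Y \<and> complete_to G {y} X \<and>
        complete_to G Z {x, y} \<and> anticomplete_to G Z ((X \<union> Y) - {x, y}))"

definition edges_between :: "('a,'b) pre_digraph \<Rightarrow> 'a set \<Rightarrow> 'a set \<Rightarrow> 'a set set" where
  "edges_between G X Y = {{u, v} | u v. u \<in> X \<and> v \<in> Y \<and> u \<rightarrow>\<^bsub>G\<^esub> v}"

definition class_C :: "('a,'b) pre_digraph \<Rightarrow> bool" where
  "class_C G \<longleftrightarrow> graph G \<and>
     (\<exists>X Y. verts G = X \<union> Y \<and> X \<inter> Y = {} \<and> clique G X \<and> clique G Y \<and>
        2 \<le> card X \<and> 2 \<le> card Y \<and>
        pairwise disjnt (edges_between G X Y) \<and> card (edges_between G X Y) = 2)"

definition basic :: "('a,'b) pre_digraph \<Rightarrow> bool" where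
  "basic G \<longleftrightarrow> is_hole 5 G \<or> is_hole 6 G \<or> split_graph G \<or> class_A G \<or> class_B G \<or> class_C G"

end

theory Submission
  imports Defs
begin

text \<open>
  A wheel or antiwheel on at most seven vertices is excluded exactly when five local rules hold:
  a vertex outside a 4-hole has at most two neighbours on it; a vertex outside an induced
  \<open>2K\<^sub>2\<close> has at least two neighbours in it; and a 5-hole, a 6-hole or the complement of a 6-hole
  is the whole graph. A hole of length at least seven contains a \<open>2K\<^sub>2\<close> and a further vertex with
  at most one neighbour in it, so the rules exclude all wheels, and they are invariant under
  complementation.

  Let \<open>G\<close> satisfy the rules and contain none of the three exceptional graphs. Without 4-holes and
  without \<open>2K\<^sub>2\<close> it is split, by the theorem of Foeldes and Hammer. With a 4-hole but without
  \<open>2K\<^sub>2\<close>, a suitable edge \<open>ab\<close> of a 4-hole exhibits \<open>G\<close> as a member of the class \<open>B\<close>, the four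
  parts being read off from the adjacency to \<open>a\<close> and \<open>b\<close>. With both, a 4-hole and a \<open>2K\<^sub>2\<close> can
  be chosen to share two vertices, adjacent ones up to complementation; the six vertices then
  determine how every other vertex attaches, and \<open>G\<close> is in \<open>A\<close> or \<open>C\<close>, or its complement in \<open>C\<close>.
\<close>

section \<open>Graphs as adjacency relations\<close>

text \<open>The rules are the hub of all equivalences: freeness up to seven vertices yields them,
  they yield freeness in every size, and they characterise the structural alternative. Wheels of
  arbitrary length are thus met only once. The bound seven is a 6-hole or its complement together
  with a hub. Nothing larger is needed by a count: a vertex outside a 5-hole has at least three
  neighbours or at least three non-neighbours on it, so it is the hub of a wheel or of an antiwheel;
  and a 6-hole contains three 2K2s that cover each of its vertices twice, which forces three
  neighbours on it. The obstacle is that \<open>G\<close> is unbounded. Where a 4-hole and a 2K2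
  coexist, the rules first leave a single vertex few ways to attach to a fixed pattern; two such
  vertices are then compared by further instances of the same rules. In the other cases local
  arguments alone may fail to single out the right edge or clique, and a choice maximising degrees
  does so.\<close>

definition c4 :: "('a \<Rightarrow> 'a \<Rightarrow> bool) \<Rightarrow> 'a \<Rightarrow> 'a \<Rightarrow> 'a \<Rightarrow> 'a \<Rightarrow> bool" where
  "c4 E a b c d \<longleftrightarrow> E a b \<and> E b c \<and> E c d \<and> E d a \<and> \<not> E a c \<and> \<not> E b d \<and> a \<noteq> c \<and> b \<noteq> d"

text \<open>No inequalities are listed here or in the patterns on five and six vertices: for a
  symmetric irreflexive relation the adjacencies force them. Only in \<open>c4\<close> could
  opposite vertices coincide.\<close>

definition two_k2 :: "('a \<Rightarrow> 'a \<Rightarrow> bool) \<Rightarrow> 'a \<Rightarrow> 'a \<Rightarrow> 'a \<Rightarrow> 'a \<Rightarrow> bool" where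
  "two_k2 E p q r s \<longleftrightarrow> E p q \<and> E r s \<and> \<not> E p r \<and> \<not> E p s \<and> \<not> E q r \<and> \<not> E q s"

definition c5 :: "('a \<Rightarrow> 'a \<Rightarrow> bool) \<Rightarrow> 'a \<Rightarrow> 'a \<Rightarrow> 'a \<Rightarrow> 'a \<Rightarrow> 'a \<Rightarrow> bool" where
  "c5 E a b c d e \<longleftrightarrow> E a b \<and> E b c \<and> E c d \<and> E d e \<and> E e a \<and>
     \<not> E a c \<and> \<not> E b d \<and> \<not> E c e \<and> \<not> E d a \<and> \<not> E e b"

definition c6 :: "('a \<Rightarrow> 'a \<Rightarrow> bool) \<Rightarrow> 'a \<Rightarrow> 'a \<Rightarrow> 'a \<Rightarrow> 'a \<Rightarrow> 'a \<Rightarrow> 'a \<Rightarrow> bool" where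
  "c6 E a b c d e f \<longleftrightarrow> E a b \<and> E b c \<and> E c d \<and> E d e \<and> E e f \<and> E f a \<and>
     \<not> E a c \<and> \<not> E b d \<and> \<not> E c e \<and> \<not> E d f \<and> \<not> E e a \<and> \<not> E f b \<and> \<not> E a d \<and> \<not> E b e \<and> \<not> E c f"

text \<open>The letters run around the hexagon of non-edges. The graph is the triangular prism with
  triangles \<open>ace\<close>, \<open>bdf\<close> and rungs \<open>ad\<close>, \<open>be\<close>,
  \<open>cf\<close>.\<close>

definition co_c6 :: "('a \<Rightarrow> 'a \<Rightarrow> bool) \<Rightarrow> 'a \<Rightarrow> 'a \<Rightarrow> 'a \<Rightarrow> 'a \<Rightarrow> 'a \<Rightarrow> 'a \<Rightarrow> bool" where
  "co_c6 E a b c d e f \<longleftrightarrow> \<not> E a b \<and> \<not> E b c \<and> \<not> E c d \<and> \<not> E d e \<and> \<not> E e f \<and> \<not> E f a \<and>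
     E a c \<and> E b d \<and> E c e \<and> E d f \<and> E e a \<and> E f b \<and> E a d \<and> E b e \<and> E c f"

text \<open>The restriction to \<open>V\<close> makes complementation an involution, so results can
  be pulled back along it.\<close>

definition compl_adj :: "'a set \<Rightarrow> ('a \<Rightarrow> 'a \<Rightarrow> bool) \<Rightarrow> 'a \<Rightarrow> 'a \<Rightarrow> bool" where
  "compl_adj V E u v \<longleftrightarrow> u \<in> V \<and> v \<in> V \<and> u \<noteq> v \<and> \<not> E u v"

definition adj_class_A :: "'a set \<Rightarrow> ('a \<Rightarrow> 'a \<Rightarrow> bool) \<Rightarrow> bool" where
  "adj_class_A V E \<longleftrightarrow> (\<exists>a b c d e X. distinct [a, b, c, d, e] \<and>
     V = {a, b, c, d, e} \<union> X \<and> {a, b, c, d, e} \<inter> X = {} \<and> c4 E a b c d \<and>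
     X \<noteq> {} \<and> (\<forall>s\<in>X. \<forall>t\<in>X. s \<noteq> t \<longrightarrow> E s t) \<and>
     (\<forall>s\<in>X. E s c \<and> E s d \<and> \<not> E s a \<and> \<not> E s b \<and> E e s) \<and>
     \<not> E e a \<and> \<not> E e b \<and> \<not> (E e c \<and> E e d))"

text \<open>
  As \<open>x\<close> is complete to \<open>Y\<close> and \<open>y\<close> to \<open>X\<close>, connectedness is automatic, and \<open>P\<^sub>5\<close>-freeness of
  \<open>X \<union> Y\<close> amounts to the absence of an induced \<open>2K\<^sub>2\<close>.
\<close>

definition adj_class_B :: "'a set \<Rightarrow> ('a \<Rightarrow> 'a \<Rightarrow> bool) \<Rightarrow> bool" where
  "adj_class_B V E \<longleftrightarrow> (\<exists>X Y Z W x y. V = X \<union> Y \<union> Z \<union> W \<and>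
     X \<inter> Y = {} \<and> X \<inter> Z = {} \<and> X \<inter> W = {} \<and> Y \<inter> Z = {} \<and> Y \<inter> W = {} \<and> Z \<inter> W = {} \<and>
     (\<forall>u\<in>X. \<forall>v\<in>X. \<not> E u v) \<and> (\<forall>u\<in>Y. \<forall>v\<in>Y. \<not> E u v) \<and>
     (\<forall>u\<in>Z. \<forall>v\<in>Z. \<not> E u v) \<and> (\<forall>u\<in>W. \<forall>v\<in>V. \<not> E u v) \<and>
     x \<in> X \<and> y \<in> Y \<and> X \<noteq> {x} \<and> Y \<noteq> {y} \<and>
     (\<forall>p\<in>X. \<forall>r\<in>X. \<forall>q\<in>Y. \<forall>s\<in>Y. E p q \<and> E r s \<longrightarrow> E p s \<or> E r q) \<and>
     (\<forall>v\<in>Y. E x v) \<and> (\<forall>u\<in>X. E y u) \<and>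
     (\<forall>z\<in>Z. E z x \<and> E z y) \<and> (\<forall>z\<in>Z. \<forall>v\<in>X \<union> Y - {x, y}. \<not> E z v))"

text \<open>Naming the two matching edges replaces all cardinalities: the sizes of the cliques and
  the number of cross edges.\<close>

definition adj_class_C :: "'a set \<Rightarrow> ('a \<Rightarrow> 'a \<Rightarrow> bool) \<Rightarrow> bool" where
  "adj_class_C V E \<longleftrightarrow> (\<exists>X Y x1 x2 y1 y2. V = X \<union> Y \<and> X \<inter> Y = {} \<and>
     (\<forall>s\<in>X. \<forall>t\<in>X. s \<noteq> t \<longrightarrow> E s t) \<and> (\<forall>s\<in>Y. \<forall>t\<in>Y. s \<noteq> t \<longrightarrow> E s t) \<and>
     x1 \<in> X \<and> x2 \<in> X \<and> x1 \<noteq> x2 \<and> y1 \<in> Y \<and> y2 \<in> Y \<and> y1 \<noteq> y2 \<and>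
     (\<forall>x\<in>X. \<forall>y\<in>Y. E x y \<longleftrightarrow> x = x1 \<and> y = y1 \<or> x = x2 \<and> y = y2))"

text \<open>The 2K2 is formed by \<open>ab\<close> and \<open>uv\<close>. How \<open>u\<close> and
  \<open>v\<close> attach to \<open>c\<close> and \<open>d\<close> is left open; it decides between
  the classes.\<close>

definition edge_sharing :: "('a \<Rightarrow> 'a \<Rightarrow> bool) \<Rightarrow> 'a \<Rightarrow> 'a \<Rightarrow> 'a \<Rightarrow> 'a \<Rightarrow> 'a \<Rightarrow> 'a \<Rightarrow> bool" where
  "edge_sharing E a b c d u v \<longleftrightarrow>
     c4 E a b c d \<and> E u v \<and> \<not> E u a \<and> \<not> E u b \<and> \<not> E v a \<and> \<not> E v b"

text \<open>The 2K2 is formed by \<open>ua\<close> and \<open>vc\<close>, so the shared vertices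
  \<open>a\<close>, \<open>c\<close> are opposite on the 4-hole.\<close>

definition nonedge_sharing :: "('a \<Rightarrow> 'a \<Rightarrow> bool) \<Rightarrow> 'a \<Rightarrow> 'a \<Rightarrow> 'a \<Rightarrow> 'a \<Rightarrow> 'a \<Rightarrow> 'a \<Rightarrow> bool" where
  "nonedge_sharing E a b c d u v \<longleftrightarrow>
     c4 E a b c d \<and> E u a \<and> E v c \<and> \<not> E u v \<and> \<not> E u c \<and> \<not> E v a"

locale sgraph =
  fixes V :: "'a set" and E :: "'a \<Rightarrow> 'a \<Rightarrow> bool"
  assumes finite_V: "finite V"
    and sym: "E u v \<Longrightarrow> E v u"
    and irrefl: "\<not> E u u"
    and in_V: "E u v \<Longrightarrow> u \<in> V"

text \<open>
  In the first two rules all distinctness conditions on \<open>v\<close> other than \<open>v \<noteq> r\<close> follow from the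
  adjacencies, and three vertices of the 4-hole or \<open>2K\<^sub>2\<close> can always be labelled as assumed.
\<close>

locale wheel_antiwheel_free = sgraph +
  assumes c4_rule: "\<lbrakk>c4 E a b c d; E v a; E v b; E v c\<rbrakk> \<Longrightarrow> False"
    and two_k2_rule: "\<lbrakk>two_k2 E p q r s; v \<in> V; v \<noteq> r; \<not> E v p; \<not> E v q; \<not> E v r\<rbrakk> \<Longrightarrow> False"
    and c5_rule: "c5 E a b c d e \<Longrightarrow> V = {a, b, c, d, e}"
    and c6_rule: "c6 E a b c d e f \<Longrightarrow> V = {a, b, c, d, e, f}"
    and co_c6_rule: "co_c6 E a b c d e f \<Longrightarrow> V = {a, b, c, d, e, f}"

locale small_hole_free = wheel_antiwheel_free +
  assumes no_c5: "\<not> c5 E a b c d e"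
    and no_c6: "\<not> c6 E a b c d e f"
    and no_co_c6: "\<not> co_c6 E a b c d e f"
begin

lemmas no_wheel4 = c4_rule[unfolded c4_def]
lemmas no_antiwheel4 = two_k2_rule[unfolded two_k2_def]
lemmas no_hole5 = no_c5[unfolded c5_def]
lemmas no_hole6 = no_c6[unfolded c6_def]
lemmas no_antihole6 = no_co_c6[unfolded co_c6_def]

lemma adj_commute: "E u v \<longleftrightarrow> E v u"
  and eq_commute_V: "(u :: 'a) = v \<longleftrightarrow> v = u"
  using sym by blast+

text \<open>
  Used as ordered rewrite rules, the two commutativity laws orient all atoms uniformly, so that a
  claim about boundedly many vertices becomes propositional. The lists of instances below are
  minimal unsatisfiable sets of such instances.
\<close>

lemmas orient_atoms = adj_commute eq_commute_V distinct.simps list.set insert_subset empty_subsetI insert_iff empty_iff simp_thms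

subsection \<open>4-holes together with 2K2\<close>

text \<open>If \<open>p\<close> is \<open>b\<close> or \<open>d\<close>, an edge is shared already.
  Otherwise look at \<open>c\<close>. If \<open>c\<close> sees \<open>p\<close>, then
  \<open>p\<close> misses \<open>b\<close> by the 4-hole rule, and \<open>a p c b\<close> is a
  4-hole sharing the edge \<open>ap\<close> with the 2K2. If not, the 2K2 rule makes
  \<open>c\<close> equal or adjacent to \<open>r\<close>, which gives a 2K2 through the non-edge
  \<open>ac\<close>.\<close>

lemma c4_two_k2_common_vertex:
  assumes no_edge: "\<And>a b c d u v. \<not> edge_sharing E a b c d u v"
    and no_nonedge: "\<And>a b c d u v. \<not> nonedge_sharing E a b c d u v"
    and "c4 E a b c d" "two_k2 E a p r s"
  shows False
  using assms(3-) no_wheel4[of a b c d p] no_antiwheel4[of a p r s c]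
    no_edge[of a p c b r s] no_edge[of a b c d r s] no_edge[of a d c b r s]
      no_nonedge[of a b c d p r] no_nonedge[of a b c d p s]
    sym irrefl in_V
  unfolding c4_def two_k2_def edge_sharing_def nonedge_sharing_def
  by (smt (verit))

text \<open>A double count shows how tight the situation is: each vertex of the 4-hole has at least
  two neighbours in the 2K2, each vertex of the 2K2 at most two on the 4-hole, so all these numbers
  are exactly two. The few patterns left fall to the listed instances.\<close>

lemma c4_two_k2_disjoint:
  assumes no_edge: "\<And>a b c d u v. \<not> edge_sharing E a b c d u v"
    and no_nonedge: "\<And>a b c d u v. \<not> nonedge_sharing E a b c d u v"
    and "c4 E a b c d" "two_k2 E p q r s"
    and "distinct [a, b, c, d, p, q, r, s]" "{a, b, c, d, p, q, r, s} \<subseteq> V"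
  shows False
  using assms(3-) no_wheel4[of a d c b p] no_wheel4[of a d c b r] no_wheel4[of a d c b s]
    no_wheel4[of b a d c p] no_wheel4[of b a d c s] no_wheel4[of b c d a s]
    no_wheel4[of c d r b s] no_antiwheel4[of d p r s b] no_antiwheel4[of r s p q a]
    no_antiwheel4[of r s p q c] no_antiwheel4[of r s p q d] no_hole5[of a b c r s]
    no_hole5[of a b c s r] no_hole5[of a b r s d] no_edge[of a b c d r s] no_edge[of a p c d r s]
    no_edge[of b c d a r s] no_edge[of c p a d r s] no_edge[of d p b a r s]
    no_edge[of r s a b p q] no_edge[of r s a d p q] no_edge[of r s c d p q]
    no_edge[of r s d a p q] no_edge[of r s d c p q] no_nonedge[of a b c d p r]
    no_nonedge[of a b c d r p] no_nonedge[of b a d c r p]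
  unfolding c4_def two_k2_def edge_sharing_def nonedge_sharing_def
  by (simp only: orient_atoms) sat

lemma c4_rotate: "c4 E a b c d \<Longrightarrow> c4 E b c d a"
  and c4_reflect: "c4 E a b c d \<Longrightarrow> c4 E b a d c"
  and two_k2_swap: "two_k2 E p q r s \<Longrightarrow> two_k2 E r s p q"
  and two_k2_flip: "two_k2 E p q r s \<Longrightarrow> two_k2 E q p r s"
  using sym unfolding c4_def two_k2_def by metis+

lemma c4_two_k2_sharing:
  assumes "c4 E a b c d" "two_k2 E p q r s"
  shows "(\<exists>a b c d u v. edge_sharing E a b c d u v) \<or> (\<exists>a b c d u v. nonedge_sharing E a b c d u v)"
proof (rule ccontr)
  assume neg: "\<not> ?thesis"
  have no_common: False if "c4 E a b c d" "two_k2 E a p r s" for a b c d p r s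
    using c4_two_k2_common_vertex[OF _ _ that] neg by blast
  \<comment> \<open>Rotating the 4-hole and flipping or swapping the 2K2 brings a common vertex to
    the first position of both patterns.\<close>
  have "x \<notin> {a, b, c, d}" if x: "x \<in> {p, q, r, s}" for x
  proof
    assume "x \<in> {a, b, c, d}"
    moreover have "two_k2 E q p r s" "two_k2 E r s p q" "two_k2 E s r p q"
      using assms(2) two_k2_swap two_k2_flip by blast+
    then obtain p' r' s' where "two_k2 E x p' r' s'"
      using x assms(2) by blast
    moreover have "c4 E b c d a" "c4 E c d a b" "c4 E d a b c"
      using assms(1) c4_rotate by blast+
    ultimately show False
      using no_common assms(1) by blast
  qed
  moreover have "distinct [a, b, c, d]" "distinct [p, q, r, s]"
    using assms sym irrefl unfolding c4_def two_k2_def by auto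
  moreover have "{a, b, c, d, p, q, r, s} \<subseteq> V"
    using assms unfolding c4_def two_k2_def by (auto intro: in_V sym)
  ultimately show False
    using neg by (intro c4_two_k2_disjoint[OF _ _ assms]) auto
qed

section \<open>Graphs with a 4-hole and a 2K2 sharing an edge\<close>

lemma class_A_extension:
  assumes "edge_sharing E a b c d u v" "E u c" "E u d" "\<not> (E v c \<and> E v d)"
    and "distinct [a, b, c, d, u, v, t]" "{a, b, c, d, u, v, t} \<subseteq> V"
  shows "E t c \<and> E t d \<and> E t u \<and> E t v \<and> \<not> E t a \<and> \<not> E t b"
  using assms no_wheel4[of a b c d t] no_wheel4[of a d c b t] no_wheel4[of b a d c t]
    no_wheel4[of b t d a c] no_wheel4[of c d v t u] no_wheel4[of c d t b u]
    no_wheel4[of d c v t u] no_wheel4[of d c t a u] no_antiwheel4[of a b u v t]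
    no_antiwheel4[of a b v u t] no_antiwheel4[of a t c u v] no_antiwheel4[of b t d u v]
    no_antiwheel4[of u v b a t] no_antiwheel4[of u v t b a] no_antiwheel4[of t v a b c]
    no_antiwheel4[of t v b a d] no_hole5[of a b c u t] no_hole5[of a b t u d]
    no_hole5[of a d u v t] no_hole5[of b c u v t] no_hole6[of a b c u v t]
    no_hole6[of a b t v u d] no_antihole6[of a c t d b u]
  unfolding c4_def edge_sharing_def
  by (simp only: orient_atoms) sat

text \<open>The six vertices already form a member of the class \<open>A\<close> with
  \<open>v\<close> as \<open>e\<close> and \<open>{u}\<close> as \<open>X\<close>. By the extension
  lemma every further vertex attaches to \<open>a\<close>, \<open>b\<close>, \<open>c\<close>,
  \<open>d\<close>, \<open>v\<close> as \<open>u\<close> does, so it joins \<open>X\<close>.\<close>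

lemma class_A_of_sharing:
  assumes sh: "edge_sharing E a b c d u v" "E u c" "E u d" "\<not> (E v c \<and> E v d)"
  shows "adj_class_A V E"
proof -
  note defs = edge_sharing_def c4_def
  define X where "X = V - {a, b, c, d, v}"
  have V: "a \<in> V" "b \<in> V" "c \<in> V" "d \<in> V" "u \<in> V" "v \<in> V"
    using sh in_V sym unfolding defs by blast+
  have dist: "distinct [a, b, c, d, v]" "u \<notin> {a, b, c, d, v}"
    using sh sym irrefl unfolding defs by (simp, metis)+
  have ext: "s = u \<or> E s u" "E s c \<and> E s d \<and> \<not> E s a \<and> \<not> E s b \<and> E v s" if "s \<in> X" for s
    using class_A_extension[OF sh, of s] that sh sym V dist unfolding X_def defs by auto
  \<comment> \<open>If \<open>s\<close> and \<open>t\<close> were non-adjacent further vertices,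
    \<open>s\<close> would have only the neighbour \<open>u\<close> in the 2K2 formed by
    \<open>ab\<close> and \<open>tu\<close>.\<close>
  have clique: "E s t" if "s \<in> X" "t \<in> X" "s \<noteq> t" for s t
    using ext[OF that(1)] ext[OF that(2)] that no_antiwheel4[of a b t u s] sh sym unfolding X_def defs
    by (metis DiffD1)
  show ?thesis
    unfolding adj_class_A_def
    using V dist ext clique sh
    by (intro exI[of _ a] exI[of _ b] exI[of _ c] exI[of _ d] exI[of _ v] exI[of _ X])
      (auto simp: X_def edge_sharing_def)
qed

text \<open>The sides grow from \<open>{a, b}\<close> and \<open>{c, d, u, v}\<close>, joined by the
  matching \<open>ad\<close>, \<open>bc\<close>. A seventh vertex imitates either the pair
  \<open>a\<close>, \<open>b\<close> or the pair \<open>u\<close>, \<open>v\<close>;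
  \<open>NA\<close> removes the attachments that would lead to the class \<open>A\<close>.\<close>

lemma class_C_of_sharing:
  assumes sh: "edge_sharing E a b c d u v" "E u c" "E u d" "E v c" "E v d"
    and NA: "\<And>a b c d u v. \<lbrakk>edge_sharing E a b c d u v; E u c; E u d\<rbrakk> \<Longrightarrow> E v c"
  shows "adj_class_C V E"
proof -
  note defs = edge_sharing_def c4_def
  have V: "a \<in> V" "b \<in> V" "c \<in> V" "d \<in> V" "u \<in> V" "v \<in> V"
    using sh in_V sym unfolding defs by blast+
  have dist: "distinct [a, b, c, d, u, v]"
    using sh sym irrefl unfolding defs by (simp, metis)
  have ext: "E t c \<and> E t d \<and> E t u \<and> E t v \<and> \<not> E t a \<and> \<not> E t b \<or>
      \<not> E t c \<and> \<not> E t d \<and> \<not> E t u \<and> \<not> E t v \<and> E t a \<and> E t b" if "t \<in> V - {a, b, c, d, u, v}" for t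
  proof -
    have "distinct [a, b, c, d, u, v, t]" "{a, b, c, d, u, v, t} \<subseteq> V"
      using that V dist by auto
    then show ?thesis
    using sh no_wheel4[of a b c d t] no_wheel4[of a d c b t] no_wheel4[of b a d c t]
      no_wheel4[of b c d a t] no_wheel4[of c d t b u] no_wheel4[of c d t b v]
      no_wheel4[of d c t a u] no_wheel4[of d c t a v] no_antiwheel4[of a b u v t]
      no_antiwheel4[of a b t u v] no_antiwheel4[of u v a b t] no_antiwheel4[of u v b a t]
      no_hole5[of a b c u t] no_hole5[of a b c v t] no_hole5[of a b t u d] no_hole5[of a b t v d]
      no_antihole6[of a c t d b u] no_antihole6[of a c t d b v] NA[of a b c d u t]
      NA[of b a d c u t]
    unfolding defs
    by (simp only: orient_atoms) sat
  qed
  define X where "X = {t \<in> V. \<not> E t u \<and> t \<noteq> u}"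
  define Y where "Y = {t \<in> V. E t u \<or> t = u}"
  have Xcase: "t = a \<or> t = b \<or> t \<in> V \<and> \<not> E t c \<and> \<not> E t d \<and> \<not> E t u \<and> \<not> E t v \<and> E t a \<and> E t b" if "t \<in> X" for t
    using that ext[of t] sh sym unfolding X_def defs by blast
  have Ycase: "t = c \<or> t = d \<or> t = u \<or> t = v \<or> t \<in> V \<and> E t c \<and> E t d \<and> E t u \<and> E t v \<and> \<not> E t a \<and> \<not> E t b" if "t \<in> Y" for t
    using that ext[of t] sh sym unfolding Y_def defs by blast
  have "\<forall>s\<in>X. \<forall>t\<in>X. s \<noteq> t \<longrightarrow> E s t"
  proof (intro ballI impI)
    fix s t assume "s \<in> X" "t \<in> X" "s \<noteq> t"
    \<comment> \<open>For two further vertices, \<open>s\<close> would see only \<open>a\<close> in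
      the 2K2 formed by \<open>cu\<close> and \<open>ta\<close>. The other side is treated alike
      with \<open>ab\<close> and \<open>tu\<close>.\<close>
    then show "E s t"
      using Xcase[of s] Xcase[of t] no_antiwheel4[of c u t a s] sh sym unfolding defs by metis
  qed
  moreover have "\<forall>s\<in>Y. \<forall>t\<in>Y. s \<noteq> t \<longrightarrow> E s t"
  proof (intro ballI impI)
    fix s t assume "s \<in> Y" "t \<in> Y" "s \<noteq> t"
    then show "E s t"
      using Ycase[of s] Ycase[of t] no_antiwheel4[of a b t u s] sh sym unfolding defs by metis
  qed
  \<comment> \<open>A third cross edge \<open>st\<close> would complete a prism with triangles
    \<open>abs\<close> and \<open>cdt\<close>.\<close>
  moreover have "\<forall>s\<in>X. \<forall>t\<in>Y. E s t \<longleftrightarrow> s = a \<and> t = d \<or> s = b \<and> t = c"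
  proof (intro ballI)
    fix s t assume "s \<in> X" "t \<in> Y"
    then show "E s t \<longleftrightarrow> s = a \<and> t = d \<or> s = b \<and> t = c"
      using Xcase[of s] Ycase[of t] no_antihole6[of a c s d b t] sh sym irrefl unfolding defs by
        (smt (verit))
  qed
  moreover have "V = X \<union> Y" "X \<inter> Y = {}" "a \<in> X" "b \<in> X" "d \<in> Y" "c \<in> Y"
    using V dist sh sym unfolding X_def Y_def defs by auto
  moreover have "a \<noteq> b" "d \<noteq> c"
    using dist by auto
  ultimately show ?thesis
    unfolding adj_class_C_def
    by (intro exI[of _ X] exI[of _ Y] exI[of _ a] exI[of _ b] exI[of _ d] exI[of _ c] conjI)
qed

text \<open>The six vertices form a ladder with rungs \<open>ab\<close>, \<open>dc\<close>,
  \<open>vu\<close>. It is bipartite with sides \<open>{a, c, v}\<close> and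
  \<open>{b, d, u}\<close> and lacks only the cross pairs \<open>au\<close> and \<open>vb\<close>;
  its complement is therefore two cliques joined by a matching of size two. A further vertex is
  complete to one side and anticomplete to the other.\<close>

lemma co_class_C_of_sharing:
  assumes sh: "edge_sharing E a b c d u v" "E u c" "E v d" "\<not> E u d" "\<not> E v c"
  shows "adj_class_C V (compl_adj V E)"
proof -
  note defs = edge_sharing_def c4_def
  have V: "a \<in> V" "b \<in> V" "c \<in> V" "d \<in> V" "u \<in> V" "v \<in> V"
    using sh in_V sym unfolding defs by blast+
  have dist: "distinct [a, b, c, d, u, v]"
    using sh sym irrefl unfolding defs by (simp, metis)
  have ext: "E t a \<and> E t c \<and> E t v \<and> \<not> E t b \<and> \<not> E t d \<and> \<not> E t u \<or>
      \<not> E t a \<and> \<not> E t c \<and> \<not> E t v \<and> E t b \<and> E t d \<and> E t u" if "t \<in> V - {a, b, c, d, u, v}" for t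
  proof -
    have "distinct [a, b, c, d, u, v, t]" "{a, b, c, d, u, v, t} \<subseteq> V"
      using that V dist by auto
    then show ?thesis
    using sh no_wheel4[of a b c d t] no_wheel4[of a d c b t] no_wheel4[of b a d c t]
      no_wheel4[of b c d a t] no_wheel4[of c u v d t] no_wheel4[of d v u c t]
      no_antiwheel4[of a b u v t] no_antiwheel4[of a b v u t] no_antiwheel4[of a t c u v]
      no_antiwheel4[of u v a b t] no_antiwheel4[of u v t a b] no_antiwheel4[of t v a b c]
      no_hole5[of a b c u t] no_hole5[of a b t v d] no_hole5[of a d c u t] no_hole5[of a d v u t]
      no_hole5[of b c u v t] no_hole6[of a b c u v t] no_hole6[of a b t u v d]
    unfolding defs
    by (simp only: orient_atoms) sat
  qed
  define X where "X = {t \<in> V. \<not> E t a \<and> \<not> E t c \<and> \<not> E t v}"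
  define Y where "Y = {t \<in> V. E t a \<or> E t c \<or> E t v}"
  have Xcase: "t = a \<or> t = c \<or> t = v \<or> \<not> E t a \<and> \<not> E t c \<and> \<not> E t v \<and> E t b \<and> E t d \<and> E t u" if "t \<in> X" for t
    using that ext[of t] sh sym unfolding X_def defs by blast
  have Ycase: "t = b \<or> t = d \<or> t = u \<or> E t a \<and> E t c \<and> E t v \<and> \<not> E t b \<and> \<not> E t d \<and> \<not> E t u" if "t \<in> Y" for t
    using that ext[of t] sh sym irrefl unfolding Y_def defs by blast
  \<comment> \<open>For two further vertices joined by an edge, \<open>s\<close> would see
    \<open>b\<close>, \<open>t\<close>, \<open>d\<close> on the 4-hole \<open>b t d a\<close>; the
    other side is symmetric.\<close>
  have XX: "\<not> E s t" if "s \<in> X" "t \<in> X" for s t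
    using Xcase[OF that(1)] Xcase[OF that(2)] no_wheel4[of b t d a s] sh sym irrefl unfolding defs by metis
  have YY: "\<not> E s t" if "s \<in> Y" "t \<in> Y" for s t
    using Ycase[OF that(1)] Ycase[OF that(2)] no_wheel4[of a t c b s] sh sym irrefl unfolding defs by metis
  \<comment> \<open>A third missing cross pair would give the 6-hole \<open>a b s u v t\<close>,
    which has \<open>s\<close> and \<open>t\<close> opposite.\<close>
  have XY: "\<not> E s t \<longleftrightarrow> s = a \<and> t = u \<or> s = v \<and> t = b" if "s \<in> X" "t \<in> Y" for s t
    using Xcase[OF that(1)] Ycase[OF that(2)] no_hole6[of a b s u v t] sh sym irrefl dist unfolding defs by (smt (verit))
  have part: "V = X \<union> Y" "X \<inter> Y = {}" and mem: "a \<in> X" "v \<in> X" "u \<in> Y" "b \<in> Y"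
    using V sh sym irrefl unfolding X_def Y_def defs by auto
  have "\<forall>s\<in>X. \<forall>t\<in>X. s \<noteq> t \<longrightarrow> compl_adj V E s t" "\<forall>s\<in>Y. \<forall>t\<in>Y. s \<noteq> t \<longrightarrow> compl_adj V E s t"
    using XX YY part unfolding compl_adj_def by blast+
  moreover have "\<forall>s\<in>X. \<forall>t\<in>Y. compl_adj V E s t \<longleftrightarrow> s = a \<and> t = u \<or> s = v \<and> t = b"
    using XY part unfolding compl_adj_def by blast
  moreover have "a \<noteq> v" "u \<noteq> b"
    using dist by auto
  ultimately show ?thesis
    unfolding adj_class_C_def using part mem
    by (intro exI[of _ X] exI[of _ Y] exI[of _ a] exI[of _ v] exI[of _ u] exI[of _ b] conjI)
qed

text \<open>The class \<open>A\<close> is settled first, over all sharing configurations of the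
  graph and not just the given one, because the class \<open>C\<close> argument needs its absence
  everywhere.\<close>

lemma edge_sharing_classes:
  assumes "edge_sharing E a b c d u v"
  shows "adj_class_A V E \<or> adj_class_C V E \<or> adj_class_C V (compl_adj V E)"
proof (cases "\<exists>a b c d u v. edge_sharing E a b c d u v \<and> E u c \<and> E u d \<and> \<not> E v c")
  case True
  then show ?thesis using class_A_of_sharing by blast
next
  case False
  then have NA: "\<And>a b c d u v. \<lbrakk>edge_sharing E a b c d u v; E u c; E u d\<rbrakk> \<Longrightarrow> E v c" by blast
  have flip: "edge_sharing E a b c d v u"
    using assms sym unfolding edge_sharing_def by blast
  \<comment> \<open>Of the edge \<open>ab\<close>, the vertex \<open>c\<close> sees only
    \<open>b\<close>, so the 2K2 rule demands a neighbour in \<open>{u, v}\<close>; likewise for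
    \<open>d\<close>.\<close>
  have "c \<in> V" "d \<in> V" "E u c \<or> E v c" "E u d \<or> E v d"
    using assms in_V sym no_antiwheel4[of u v a b c] no_antiwheel4[of u v b a d] unfolding edge_sharing_def c4_def by metis+
  then consider "E u c" "E u d" | "E v c" "E v d" | "E u c" "E v d" "\<not> E u d" "\<not> E v c" | "E v c" "E u d" "\<not> E v d" "\<not> E u c"
    by blast
  then show ?thesis
  proof cases
    case 1
    then show ?thesis
      using class_C_of_sharing[OF assms] class_A_of_sharing[OF assms] NA by meson
  next
    case 2
    then show ?thesis
      using class_C_of_sharing[OF flip] class_A_of_sharing[OF flip] NA by meson
  next
    case 3
    then show ?thesis using co_class_C_of_sharing[OF assms] by blast
  next
    case 4
    then show ?thesis using co_class_C_of_sharing[OF flip] by blast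
  qed
qed

subsection \<open>4-holes without 2K2\<close>

text \<open>Once the edge \<open>ab\<close> is to play the role of \<open>xy\<close>, the four parts
  have no freedom left. This isolates what a good edge must satisfy; two different ways of choosing
  one feed it.\<close>

lemma class_B_of_edge:
  assumes no_2k2: "\<And>p q r s. \<not> two_k2 E p q r s"
    and c4: "c4 E a b c d"
    and XX: "\<And>p q. \<lbrakk>E p b; \<not> E p a; E q b; \<not> E q a\<rbrakk> \<Longrightarrow> \<not> E p q"
    and YY: "\<And>p q. \<lbrakk>E p a; \<not> E p b; E q a; \<not> E q b\<rbrakk> \<Longrightarrow> \<not> E p q"
    and Z: "\<And>z p. \<lbrakk>E z a; E z b; E z p\<rbrakk> \<Longrightarrow> p = a \<or> p = b"
    and W: "\<And>w p. \<lbrakk>\<not> E w a; \<not> E w b\<rbrakk> \<Longrightarrow> \<not> E w p"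
  shows "adj_class_B V E"
proof -
  define X where "X = {v \<in> V. E v b \<and> \<not> E v a}"
  define Y where "Y = {v \<in> V. E v a \<and> \<not> E v b}"
  define Z where "Z = {v \<in> V. E v a \<and> E v b}"
  define W where "W = {v \<in> V. \<not> E v a \<and> \<not> E v b}"
  note sets = X_def Y_def Z_def W_def
  have "V = X \<union> Y \<union> Z \<union> W" "X \<inter> Y = {}" "X \<inter> Z = {}" "X \<inter> W = {}" "Y \<inter> Z = {}" "Y \<inter> W = {}" "Z \<inter> W = {}"
    unfolding sets by blast+
  moreover have "\<forall>u\<in>X. \<forall>v\<in>X. \<not> E u v" "\<forall>u\<in>Y. \<forall>v\<in>Y. \<not> E u v" "\<forall>u\<in>W. \<forall>v\<in>V. \<not> E u v"
    unfolding sets using XX YY W by blast+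
  moreover have "\<forall>u\<in>Z. \<forall>v\<in>Z. \<not> E u v"
    unfolding sets using Z irrefl by blast
  moreover have "a \<in> X" "b \<in> Y" "c \<in> X" "d \<in> Y" "c \<noteq> a" "d \<noteq> b"
    using c4 in_V sym irrefl unfolding sets c4_def by blast+
  moreover from this have "X \<noteq> {a}" "Y \<noteq> {b}" by blast+
  moreover have "\<forall>p\<in>X. \<forall>r\<in>X. \<forall>q\<in>Y. \<forall>s\<in>Y. E p q \<and> E r s \<longrightarrow> E p s \<or> E r q"
  proof (intro ballI impI)
    fix p r q s assume "p \<in> X" "r \<in> X" "q \<in> Y" "s \<in> Y" "E p q \<and> E r s"
    then show "E p s \<or> E r q"
      using no_2k2[of p q r s] XX[of p r] YY[of q s] sym unfolding sets two_k2_def by blast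
  qed
  moreover have "\<forall>v\<in>Y. E a v" "\<forall>u\<in>X. E b u" "\<forall>z\<in>Z. E z a \<and> E z b"
    unfolding sets using sym by blast+
  moreover have "\<forall>z\<in>Z. \<forall>v\<in>X \<union> Y - {a, b}. \<not> E z v"
    using Z unfolding Z_def by blast
  ultimately show ?thesis
    unfolding adj_class_B_def
    by (intro exI[of _ X] exI[of _ Y] exI[of _ Z] exI[of _ W] exI[of _ a] exI[of _ b] conjI)
qed

text \<open>All three claims concern vertices that see \<open>b\<close> but not \<open>a\<close>;
  reflecting the 4-hole yields the same for \<open>a\<close>. By the 4-hole rule \<open>u\<close>
  misses \<open>c\<close> and \<open>d\<close>, so any unwanted edge closes a 2K2, a 5-hole, a prism
  or a wheel on a 4-hole.\<close>

lemma triangle_on_c4: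
  assumes no_2k2: "\<And>p q r s. \<not> two_k2 E p q r s"
    and c4: "c4 E a b c d" and u: "E u a" "E u b"
  shows "\<lbrakk>E p b; \<not> E p a; E q b; \<not> E q a\<rbrakk> \<Longrightarrow> \<not> E p q"
    and "\<lbrakk>E p b; \<not> E p a; p \<noteq> a\<rbrakk> \<Longrightarrow> \<not> E u p"
    and "\<lbrakk>E w p; \<not> E w a; \<not> E w b; E p b\<rbrakk> \<Longrightarrow> E p a"
proof -
  note no_two_k2 = no_2k2[unfolded two_k2_def]
  note defs = c4_def
  have dist: "distinct [a, b, c, d, u]"
    using c4 u sym irrefl unfolding c4_def by auto
  have uc: "\<not> E u c" "\<not> E u d"
    using c4 u no_wheel4[of a b c d u] no_wheel4[of b a d c u] sym unfolding defs by blast+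
  have Xc: "\<not> E p c" if "E p b" "\<not> E p a" for p
    using that c4 u uc no_wheel4[of b c d a p] no_hole5[of a d c p u] no_two_k2[of a u c p] sym
      irrefl
    unfolding defs by metis
  show "\<not> E p q" if pq: "E p b" "\<not> E p a" "E q b" "\<not> E q a"
  proof
    assume "E p q"
    then have "distinct [a, b, c, d, u, p, q]"
      using pq Xc[of p] Xc[of q] dist c4 u sym irrefl unfolding defs by auto
    then show False
      using \<open>E p q\<close> pq c4 u uc no_wheel4[of a b p d u] no_wheel4[of a b q d u]
        no_hole5[of a d p q u] no_hole5[of a d q p u] no_two_k2[of a d p q] no_two_k2[of a u p q]
      unfolding defs by (simp only: orient_atoms) sat
  qed
  show "\<not> E u p" if p: "E p b" "\<not> E p a" "p \<noteq> a"
  proof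
    assume "E u p"
    then have "distinct [a, b, c, d, u, p]"
      using p uc dist c4 u sym irrefl unfolding defs by auto
    then show False
      using \<open>E u p\<close> p c4 u uc no_wheel4[of a b p d u] no_hole5[of a d c p u]
        no_two_k2[of c d p u]
      unfolding defs by (simp only: orient_atoms) sat
  qed
  show "E p a" if p: "E w p" "\<not> E w a" "\<not> E w b" "E p b"
  proof (rule ccontr)
    assume "\<not> E p a"
    \<comment> \<open>If \<open>w\<close> saw \<open>c\<close>, then the absence of a 2K2 would
      force \<open>uw\<close>, the absence of a 5-hole would force \<open>dw\<close>, and
      \<open>abu\<close>, \<open>cdw\<close> would be the triangles of a prism.\<close>
    have "\<not> E w c" 
      using p c4 u uc  no_hole5[of a d c w u] no_antihole6[of a c u d b w] no_two_k2[of a u c w] dist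
      unfolding defs by (simp only: orient_atoms) sat
    with \<open>\<not> E p a\<close> have "distinct [a, b, c, d, u, p, w]"
      using p dist c4 u sym irrefl unfolding defs by auto
    then show False
      using \<open>\<not> E p a\<close> p c4 u uc no_wheel4[of a b p d u] no_hole5[of a b p w d]
        no_hole5[of a d p w u] no_antihole6[of a p u d b w] no_two_k2[of a d p w]
        no_two_k2[of a u p w]
      unfolding defs by (simp only: orient_atoms) sat
  qed
qed

lemma class_B_of_triangle_on_c4:
  assumes no_2k2: "\<And>p q r s. \<not> two_k2 E p q r s"
    and c4: "c4 E a b c d" and u: "E u a" "E u b"
  shows "adj_class_B V E"
proof (rule class_B_of_edge[OF no_2k2 c4])
  note ab = triangle_on_c4[OF no_2k2 c4]
  note ba = triangle_on_c4[OF no_2k2 c4_reflect[OF c4]]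
  show "\<not> E p q" if "E p b" "\<not> E p a" "E q b" "\<not> E q a" for p q
    using ab(1)[OF u] that by blast
  show "\<not> E p q" if "E p a" "\<not> E p b" "E q a" "\<not> E q b" for p q
    using ba(1)[OF u(2,1)] that by blast
  show "p = a \<or> p = b" if z: "E z a" "E z b" "E z p" for z p
  proof (rule ccontr)
    assume neg: "\<not> ?thesis"
    have zcd: "\<not> E z c" "\<not> E z d" "\<not> E p c \<or> \<not> E p a \<or> \<not> E p b" "\<not> E p d \<or> \<not> E p a \<or> \<not> E p b"
      using c4 z no_wheel4[of a b c d] no_wheel4[of b a d c] sym unfolding c4_def by blast+
    consider "E p a" "E p b" | "E p a" "\<not> E p b" | "E p b" "\<not> E p a" | "\<not> E p a" "\<not> E p b" by blast
    then show False
    proof cases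
      case 1
      then show False
        using zcd z c4 no_2k2[of c d z p] sym unfolding c4_def two_k2_def by blast
    next
      case 2
      then show False using ba(2)[OF z(2,1)] neg z(3) by blast
    next
      case 3
      then show False using ab(2)[OF z(1,2)] neg z(3) by blast
    next
      case 4
      \<comment> \<open>Seeing exactly one of \<open>c\<close>, \<open>d\<close> closes a 5-hole
        through \<open>z\<close>; seeing both gives a prism with triangles \<open>abz\<close> and
        \<open>cdp\<close>.\<close>
      have "\<not> E p c" "\<not> E p d"
        using 4 z zcd c4 no_hole5[of a d c p z] no_hole5[of b c d p z]
          no_antihole6[of a c z d b p] sym irrefl neg
        unfolding c4_def by blast+
      then show False
        using zcd z c4 no_2k2[of c d z p] sym unfolding c4_def two_k2_def by blast
    qed
  qed
  show "\<not> E w p" if w: "\<not> E w a" "\<not> E w b" for w p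
  proof
    assume wp: "E w p"
    \<comment> \<open>As \<open>wp\<close> and \<open>ab\<close> form no 2K2, \<open>p\<close> sees
      one of \<open>a\<close>, \<open>b\<close> and hence both; then the previous claim, with
      \<open>p\<close> as common neighbour, leaves no room for \<open>w\<close>.\<close>
    have "E p a \<longleftrightarrow> E p b"
      using ab(3)[OF u wp w] ba(3)[OF u(2,1) wp w(2,1)] by blast
    moreover have "E p a \<or> E p b"
      using no_2k2[of w p a b] wp w c4 sym unfolding c4_def two_k2_def by blast
    ultimately show False
      using \<open>\<And>z p. \<lbrakk>E z a; E z b; E z p\<rbrakk> \<Longrightarrow> p = a \<or> p = b\<close>[of p w] wp w c4 sym
      unfolding c4_def by blast
  qed
qed

text \<open>An edge of a 4-hole that lies in a triangle works as it stands. If there is none, an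
  arbitrary edge may still leave a vertex of \<open>W\<close> with neighbours; maximising the degree
  sum of the ends excludes this.\<close>

lemma class_B_of_c4:
  assumes no_2k2: "\<And>p q r s. \<not> two_k2 E p q r s"
    and "c4 E a0 b0 c0 d0"
  shows "adj_class_B V E"
proof (cases "\<exists>a b c d u. c4 E a b c d \<and> E u a \<and> E u b")
  case True
  then show ?thesis using class_B_of_triangle_on_c4[OF no_2k2] by blast
next
  case False
  then have no_triangle: "\<And>a b c d u. c4 E a b c d \<Longrightarrow> E u a \<Longrightarrow> \<not> E u b" by blast
  define deg where "deg v = card {u. E u v}" for v
  have fin: "finite {u. E u v}" for v
    using in_V by (auto intro: finite_subset[OF _ finite_V])
  obtain a b c d where c4: "c4 E a b c d"
    and max: "\<forall>a' b' c' d'. c4 E a' b' c' d' \<longrightarrow> deg a' + deg b' \<le> deg a + deg b"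
  proof -
    let ?Q = "\<lambda>n. \<exists>a b c d. c4 E a b c d \<and> n = deg a + deg b"
    have "deg v \<le> card V" for v
      unfolding deg_def using in_V by (intro card_mono finite_V) blast
    then have bound: "\<forall>n. ?Q n \<longrightarrow> n < Suc (card V + card V)"
      by (auto simp: less_Suc_eq_le intro: add_mono)
    have "?Q (deg a0 + deg b0)" using assms(2) by blast
    from ex_has_greatest_nat[where f = "\<lambda>n. n", OF this bound]
    obtain n where n: "?Q n \<and> (\<forall>m. ?Q m \<longrightarrow> m \<le> n)" by (rule exE)
    then obtain a b c d where "c4 E a b c d" "n = deg a + deg b" by blast
    then show thesis using n by (intro that[of a b c d]) blast+
  qed
  \<comment> \<open>No triangle lies on \<open>bc\<close>, so an edge \<open>pq\<close> misses
    \<open>c\<close>. To avoid a 2K2 with \<open>cd\<close>, one end sees \<open>d\<close>, and then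
    the triangle \<open>bpq\<close> has an edge on a 4-hole through \<open>b\<close>,
    \<open>d\<close>, \<open>a\<close>.\<close>
  have XX: "\<not> E p q" if c4: "c4 E a b c d" and pq: "E p b" "\<not> E p a" "E q b" "\<not> E q a" for a b c d p q
    using pq c4 no_2k2[of c d p q] no_triangle[OF c4_rotate[OF c4], of p] no_triangle[OF c4_rotate[OF c4], of q]
      no_triangle[of b p d a q] no_triangle[of b q d a p] sym irrefl
    unfolding c4_def two_k2_def by metis
  have WX: False
    if c4: "c4 E a b c d" and max: "\<forall>a' b' c' d'. c4 E a' b' c' d' \<longrightarrow> deg a' + deg b' \<le> deg a + deg b"
      and w: "\<not> E w a" "\<not> E w b" "E w p" "E p b" "\<not> E p a" for a b c d w p
  proof -
    \<comment> \<open>Otherwise \<open>at\<close> and \<open>pw\<close> form no 2K2 only if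
      \<open>tw\<close> is an edge, and then \<open>a b p w t\<close> is a 5-hole. So
      \<open>p\<close> sees all neighbours of \<open>a\<close> and in addition \<open>w\<close>,
      which makes \<open>pb\<close> a better edge.\<close>
    have "E t p" if "E t a" for t
      using that w c4 no_hole5[of a b p w t] no_2k2[of a t p w] no_triangle[OF c4, of t] sym irrefl
      unfolding two_k2_def c4_def by metis
    then have sub: "{t. E t a} \<subset> {t. E t p}" using w(1,3) by blast
    then have "deg a < deg p" unfolding deg_def by (intro psubset_card_mono fin)
    \<comment> \<open>The second alternative is the case \<open>p = c\<close>.\<close>
    moreover have "c4 E p b c d \<or> c4 E p b a d"
      using c4 w sub no_triangle[OF c4_rotate[OF c4], of p] sym irrefl unfolding c4_def by blast
    ultimately show False using max by fastforce
  qed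
  show ?thesis
  proof (rule class_B_of_edge[OF no_2k2 c4])
    show "\<not> E p q" if "E p b" "\<not> E p a" "E q b" "\<not> E q a" for p q
      using XX[OF c4] that by blast
    show "\<not> E p q" if "E p a" "\<not> E p b" "E q a" "\<not> E q b" for p q
      using XX[OF c4_reflect[OF c4]] that by blast
    show "p = a \<or> p = b" if "E z a" "E z b" "E z p" for z p
      using no_triangle[OF c4] that by blast
    have max': "\<forall>a' b' c' d'. c4 E a' b' c' d' \<longrightarrow> deg a' + deg b' \<le> deg b + deg a"
      using max by (simp add: add.commute)
    show "\<not> E w p" if "\<not> E w a" "\<not> E w b" for w p
    proof
      assume "E w p"
      moreover have "E p a \<or> E p b"
        using no_2k2[of w p a b] \<open>E w p\<close> that c4 sym unfolding c4_def two_k2_def by blast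
      moreover have "\<not> (E p a \<and> E p b)"
        using no_triangle[OF c4] by blast
      ultimately show False
        using WX[OF c4 max] WX[OF c4_reflect[OF c4] max'] that by blast
    qed
  qed
qed

end

section \<open>Split graphs\<close>

context sgraph begin

text \<open>The clique is chosen with maximum degree sum among the maximum cliques.\<close>

lemma split_if_no_c4_two_k2_c5:
  assumes no_c4: "\<And>a b c d. \<not> c4 E a b c d"
    and no_2k2: "\<And>p q r s. \<not> two_k2 E p q r s"
    and no_c5: "\<And>a b c d e. \<not> c5 E a b c d e"
  obtains K where "K \<subseteq> V" "\<And>u v. \<lbrakk>u \<in> K; v \<in> K; u \<noteq> v\<rbrakk> \<Longrightarrow> E u v"
    "\<And>u v. \<lbrakk>u \<in> V - K; v \<in> V - K\<rbrakk> \<Longrightarrow> \<not> E u v"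
proof -
  define cl where "cl K \<longleftrightarrow> K \<subseteq> V \<and> (\<forall>u\<in>K. \<forall>v\<in>K. u \<noteq> v \<longrightarrow> E u v)" for K
  define deg where "deg v = card {u. E u v}" for v
  have fin: "finite {u. E u v}" for v
    using in_V by (auto intro: finite_subset[OF _ finite_V])
  have finK: "finite K" if "cl K" for K
    using that by (auto simp: cl_def intro: finite_subset[OF _ finite_V])
  obtain K0 where K0: "cl K0" "\<And>L. cl L \<Longrightarrow> card L \<le> card K0"
  proof -
    have "cl {}" "\<forall>L. cl L \<longrightarrow> card L < Suc (card V)"
      unfolding cl_def using card_mono[OF finite_V] by (auto simp: less_Suc_eq_le)
    from ex_has_greatest_nat[OF this] show thesis using that by auto
  qed
  let ?P = "\<lambda>K. cl K \<and> card K = card K0"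
  obtain K where K: "?P K" and max: "\<And>L. ?P L \<Longrightarrow> sum deg L \<le> sum deg K"
  proof -
    have bound: "\<forall>L. ?P L \<longrightarrow> sum deg L < Suc (sum deg V)"
      unfolding cl_def by (auto simp: less_Suc_eq_le intro!: sum_mono2 finite_V)
    have "?P K0" using K0(1) by simp
    from ex_has_greatest_nat[OF this bound] show thesis using that by auto
  qed
  have maxcard: "card L \<le> card K" if "cl L" for L
    using K0(2)[OF that] K by simp
  have clK: "K \<subseteq> V" "\<And>u v. \<lbrakk>u \<in> K; v \<in> K; u \<noteq> v\<rbrakk> \<Longrightarrow> E u v" "finite K"
    using K finK unfolding cl_def by blast+
  have nonnb: "\<exists>z\<in>K. \<not> E x z" if "x \<in> V - K" for x
  proof (rule ccontr)
    assume "\<not> ?thesis"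
    then have "cl (insert x K)"
      using that clK sym unfolding cl_def by blast
    from maxcard[OF this] that clK(3) show False by simp
  qed
  \<comment> \<open>The heart of the argument is an edge \<open>xy\<close> outside \<open>K\<close>
    where \<open>x\<close> sees every vertex of \<open>K\<close> that \<open>y\<close> sees. Then
    \<open>x\<close> misses a single \<open>z\<close>, since two missed vertices would form a 2K2
    with \<open>xy\<close>, and \<open>x\<close> can be exchanged for \<open>z\<close>.\<close>
  have False if xy: "x \<in> V - K" "y \<in> V - K" "E x y" and sub: "\<And>z. z \<in> K \<Longrightarrow> \<not> E x z \<Longrightarrow> \<not> E y z" for x y
  proof -
    obtain z where z: "z \<in> K" "\<not> E x z" using nonnb xy(1) by blast
    have only_z: "E x w" if "w \<in> K" "w \<noteq> z" for w
    proof (rule ccontr)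
      assume "\<not> E x w"
      then have "two_k2 E x y z w"
        using that z sub xy clK(2) unfolding two_k2_def by blast
      then show False using no_2k2 by blast
    qed
    define L where "L = insert x (K - {z})"
    have cardL: "card L = card K"
      unfolding L_def using z xy clK(3) card_Suc_Diff1[OF clK(3) z(1)] by simp
    have clL: "cl L"
      using clK only_z xy sym unfolding cl_def L_def by blast
    \<comment> \<open>If \<open>y\<close> missed only \<open>z\<close>, adding both \<open>x\<close>
      and \<open>y\<close> to \<open>K\<close> without \<open>z\<close> would give a larger
      clique.\<close>
    have "\<exists>w\<in>K. w \<noteq> z \<and> \<not> E y w"
    proof (rule ccontr)
      assume "\<not> ?thesis"
      then have "cl (insert y L)"
        using clL xy sym unfolding cl_def L_def by blast
      moreover have "y \<notin> L" "finite L"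
        using xy irrefl clK(3) unfolding L_def by auto
      ultimately show False using maxcard[of "insert y L"] cardL by simp
    qed
    then obtain w where w: "w \<in> K" "w \<noteq> z" "\<not> E y w" by blast
    \<comment> \<open>By the extremal choice \<open>z\<close> has at least the degree of
      \<open>x\<close>. As \<open>y\<close> is a neighbour of \<open>x\<close> but not of
      \<open>z\<close>, some \<open>t\<close> is a neighbour of \<open>z\<close> but not of
      \<open>x\<close>.\<close>
    have "sum deg L \<le> sum deg K"
      using max clL cardL K by auto
    then have "deg x \<le> deg z"
      using z xy clK(3) unfolding L_def by (simp add: sum.remove[of K z])
    moreover have "y \<in> {t. E t x}" "y \<notin> {t. E t z}"
      using xy z sub sym by blast+
    ultimately have "\<not> {t. E t z} \<subseteq> {t. E t x}"
      unfolding deg_def using psubset_card_mono[OF fin, of "{t. E t z}" x] by fastforce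
    then obtain t where t: "E t z" "\<not> E t x" by blast
    then have "t \<noteq> x" "t \<noteq> y" using z xy sym by blast+
    have "E t y"
      using no_2k2[of t z x y] t z xy sub sym unfolding two_k2_def by blast
    show False
    proof (cases "E t w")
      case True
      then have "c4 E x y t w"
        using xy w t \<open>E t y\<close> only_z[OF w(1,2)] \<open>t \<noteq> x\<close> sym unfolding c4_def by blast
      then show False using no_c4 by blast
    next
      case False
      then have "c5 E x y t z w"
        using xy w t z \<open>E t y\<close> only_z[OF w(1,2)] clK(2) sub sym unfolding c5_def by blast
      then show False using no_c5 by blast
    qed
  qed note nested = this
  have "\<not> E x y" if xy: "x \<in> V - K" "y \<in> V - K" for x y
  proof
    assume "E x y"
    \<comment> \<open>Without nesting in either direction, each end of the edge has a private
      neighbour in \<open>K\<close>, and these close a 4-hole.\<close>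
    obtain u v where u: "u \<in> K" "\<not> E x u" "E y u" and v: "v \<in> K" "\<not> E y v" "E x v"
      using nested[OF xy \<open>E x y\<close>] nested[OF xy(2,1) sym[OF \<open>E x y\<close>]] by blast
    then have "c4 E x y u v"
      using xy \<open>E x y\<close> clK(2) sym unfolding c4_def by blast
    then show False using no_c4 by blast
  qed
  then show thesis using that[of K] clK by blast
qed

end

section \<open>Complementation and the structure theorem\<close>

definition adj_split :: "'a set \<Rightarrow> ('a \<Rightarrow> 'a \<Rightarrow> bool) \<Rightarrow> bool" where
  "adj_split V E \<longleftrightarrow> (\<exists>S K. V = S \<union> K \<and> S \<inter> K = {} \<and>
     (\<forall>u\<in>S. \<forall>v\<in>S. \<not> E u v) \<and> (\<forall>u\<in>K. \<forall>v\<in>K. u \<noteq> v \<longrightarrow> E u v))"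

definition adj_basic :: "'a set \<Rightarrow> ('a \<Rightarrow> 'a \<Rightarrow> bool) \<Rightarrow> bool" where
  "adj_basic V E \<longleftrightarrow> (\<exists>a b c d e. c5 E a b c d e \<and> V = {a, b, c, d, e}) \<or>
     (\<exists>a b c d e f. c6 E a b c d e f \<and> V = {a, b, c, d, e, f}) \<or>
     adj_split V E \<or> adj_class_A V E \<or> adj_class_B V E \<or> adj_class_C V E"

lemma adj_basicI:
  "adj_split V E \<Longrightarrow> adj_basic V E" "adj_class_A V E \<Longrightarrow> adj_basic V E"
  "adj_class_B V E \<Longrightarrow> adj_basic V E" "adj_class_C V E \<Longrightarrow> adj_basic V E"
  by (simp_all add: adj_basic_def)

context sgraph begin

lemma compl_adj_compl_adj: "compl_adj V (compl_adj V E) = E"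
  using in_V sym irrefl by (fastforce simp: compl_adj_def fun_eq_iff)

lemma sgraph_compl_adj: "sgraph V (compl_adj V E)"
  using finite_V sym by unfold_locales (auto simp: compl_adj_def)

text \<open>The relabellings read off the non-edges: the diagonals of a 4-cycle, and the pentagram
  \<open>a c e b d\<close> inside a 5-cycle.\<close>

lemma c4_compl_adj: "c4 (compl_adj V E) a b c d \<Longrightarrow> two_k2 E a c b d"
  and two_k2_compl_adj: "two_k2 (compl_adj V E) p q r s \<Longrightarrow> c4 E p r q s"
  and c5_compl_adj: "c5 (compl_adj V E) a b c d e \<Longrightarrow> c5 E a c e b d"
  and c6_compl_adj: "c6 (compl_adj V E) a b c d e f \<Longrightarrow> co_c6 E a b c d e f"
  and co_c6_compl_adj: "co_c6 (compl_adj V E) a b c d e f \<Longrightarrow> c6 E a b c d e f"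
  using sym unfolding c4_def two_k2_def c5_def c6_def co_c6_def compl_adj_def by metis+

lemma distinct_hole: "c5 E a b c d e \<Longrightarrow> distinct [a, b, c, d, e]"
  "c6 E a b c d e f \<Longrightarrow> distinct [a, b, c, d, e, f]"
  "co_c6 E a b c d e f \<Longrightarrow> distinct [a, b, c, d, e, f]"
  using sym irrefl unfolding c5_def c6_def co_c6_def by (simp, metis)+

end

context wheel_antiwheel_free begin

text \<open>Complementation exchanges the first two rules and the last two, and fixes the one on
  5-holes.\<close>

lemma wheel_antiwheel_free_compl_adj: "wheel_antiwheel_free V (compl_adj V E)"
proof -
  interpret C: sgraph V "compl_adj V E" by (rule sgraph_compl_adj)
  show ?thesis
  proof
    fix a b c d v
    assume 1: "c4 (compl_adj V E) a b c d" and 2: "compl_adj V E v a" "compl_adj V E v b" "compl_adj V E v c"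
    from two_k2_rule[OF c4_compl_adj[OF 1], of v] 2 show False
      by (auto simp: compl_adj_def)
  next
    fix p q r s v
    assume 1: "two_k2 (compl_adj V E) p q r s" and 2: "v \<in> V" "v \<noteq> r" "\<not> compl_adj V E v p" "\<not> compl_adj V E v q" "\<not> compl_adj V E v r"
    have "v \<noteq> p" "v \<noteq> q" "p \<in> V" "q \<in> V" "r \<in> V"
      using 1 2 sym by (auto simp: two_k2_def compl_adj_def)
    then have "E v p" "E v r" "E v q"
      using 2 by (auto simp: compl_adj_def)
    then show False using c4_rule[OF two_k2_compl_adj[OF 1]] by blast
  next
    fix a b c d e assume "c5 (compl_adj V E) a b c d e"
    from c5_rule[OF c5_compl_adj[OF this]] show "V = {a, b, c, d, e}" by auto
  next
    fix a b c d e f assume "c6 (compl_adj V E) a b c d e f"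
    from co_c6_rule[OF c6_compl_adj[OF this]] show "V = {a, b, c, d, e, f}" .
  next
    fix a b c d e f assume "co_c6 (compl_adj V E) a b c d e f"
    from c6_rule[OF co_c6_compl_adj[OF this]] show "V = {a, b, c, d, e, f}" .
  qed
qed

end

lemma (in small_hole_free) small_hole_free_compl_adj: "small_hole_free V (compl_adj V E)"
proof -
  interpret C: wheel_antiwheel_free V "compl_adj V E" by (rule wheel_antiwheel_free_compl_adj)
  show ?thesis
    using c5_compl_adj c6_compl_adj co_c6_compl_adj no_c5 no_c6 no_co_c6
    by unfold_locales metis+
qed

lemma (in sgraph) c4_compl_adj_of_two_k2:
  "two_k2 E p q r s \<Longrightarrow> c4 (compl_adj V E) p r q s"
  using in_V sym irrefl unfolding c4_def two_k2_def compl_adj_def by metis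

text \<open>In the complement the diagonals \<open>ac\<close>, \<open>bd\<close> form the 2K2, while
  the old 2K2 becomes the 4-hole \<open>c a v u\<close>; the shared non-edge \<open>ac\<close> is
  now a shared edge.\<close>

lemma (in small_hole_free) edge_sharing_compl_adj:
  assumes "nonedge_sharing E a b c d u v"
  shows "edge_sharing (compl_adj V E) c a v u b d"
  using assms in_V sym irrefl unfolding nonedge_sharing_def edge_sharing_def c4_def compl_adj_def
  by metis

lemma (in small_hole_free) basic_of_small_hole_free:
  "adj_basic V E \<or> adj_basic V (compl_adj V E)"
proof -
  interpret C: small_hole_free V "compl_adj V E" by (rule small_hole_free_compl_adj)
  consider (both) a b c d p q r s where "c4 E a b c d" "two_k2 E p q r s"
    | (c4) a b c d where "c4 E a b c d" "\<forall>p q r s. \<not> two_k2 E p q r s"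
    | (two_k2) p q r s where "two_k2 E p q r s" "\<forall>a b c d. \<not> c4 E a b c d"
    | (none) "\<forall>a b c d. \<not> c4 E a b c d" "\<forall>p q r s. \<not> two_k2 E p q r s"
    by metis
  then show ?thesis
  proof cases
    case both
    then consider a b c d u v where "edge_sharing E a b c d u v" | a b c d u v where "nonedge_sharing E a b c d u v"
      using c4_two_k2_sharing by metis
    then show ?thesis
    proof cases
      case 1
      then show ?thesis using edge_sharing_classes adj_basicI by blast
    next
      case 2
      then show ?thesis
        using C.edge_sharing_classes[OF edge_sharing_compl_adj] compl_adj_compl_adj adj_basicI by metis
    qed
  next
    case c4
    then show ?thesis using class_B_of_c4 adj_basicI by blast
  next
    case two_k2
    then have "\<not> two_k2 (compl_adj V E) p q r s" for p q r s
      using two_k2_compl_adj by blast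
    then show ?thesis
      using C.class_B_of_c4 c4_compl_adj_of_two_k2[OF two_k2(1)] adj_basicI by blast
  next
    case none
    then obtain K where "K \<subseteq> V" "\<And>u v. \<lbrakk>u \<in> K; v \<in> K; u \<noteq> v\<rbrakk> \<Longrightarrow> E u v"
      "\<And>u v. \<lbrakk>u \<in> V - K; v \<in> V - K\<rbrakk> \<Longrightarrow> \<not> E u v"
      using split_if_no_c4_two_k2_c5 no_c5 by metis
    then have "adj_split V E"
      unfolding adj_split_def by (intro exI[of _ "V - K"] exI[of _ K]) auto
    then show ?thesis using adj_basicI by blast
  qed
qed

theorem (in wheel_antiwheel_free) adj_basic: "adj_basic V E \<or> adj_basic V (compl_adj V E)"
proof (cases "small_hole_free V E")
  case True
  then show ?thesis by (rule small_hole_free.basic_of_small_hole_free)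
next
  case False
  then consider a b c d e where "c5 E a b c d e" | a b c d e f where "c6 E a b c d e f"
    | a b c d e f where "co_c6 E a b c d e f"
    using wheel_antiwheel_free_axioms unfolding small_hole_free_def small_hole_free_axioms_def by blast
  then show ?thesis
  proof cases
    case 1
    then show ?thesis using c5_rule unfolding adj_basic_def by metis
  next
    case 2
    then show ?thesis using c6_rule unfolding adj_basic_def by metis
  next
    case 3
    interpret C: wheel_antiwheel_free V "compl_adj V E" by (rule wheel_antiwheel_free_compl_adj)
    have "c6 (compl_adj V E) a b c d e f"
      using 3 distinct_hole(3)[OF 3] co_c6_rule[OF 3] unfolding c6_def co_c6_def compl_adj_def by auto
    then show ?thesis using C.c6_rule unfolding adj_basic_def by metis
  qed
qed

section \<open>The basic graphs satisfy the rules\<close>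

context sgraph begin

lemma c6_imp_two_k2: "c6 E a b c d e f \<Longrightarrow> two_k2 E a b d e"
  and co_c6_imp_c4: "co_c6 E a b c d e f \<Longrightarrow> c4 E a d b e"
  using sym irrefl unfolding c4_def two_k2_def c6_def co_c6_def by metis+

text \<open>In a 4-, 5- or 6-hole and in a prism every vertex has two non-adjacent neighbours, so
  simplicial vertices avoid these patterns. Dually, in a 2K2 and in a prism every vertex has two
  adjacent non-neighbours.\<close>

definition simplicial :: "'a \<Rightarrow> bool" where
  "simplicial v \<longleftrightarrow> (\<forall>u w. E v u \<and> E v w \<and> u \<noteq> w \<longrightarrow> E u w)"

definition cosimplicial :: "'a \<Rightarrow> bool" where
  "cosimplicial v \<longleftrightarrow> (\<forall>u\<in>V. \<forall>w\<in>V. u \<noteq> v \<and> w \<noteq> v \<and> \<not> E v u \<and> \<not> E v w \<longrightarrow> \<not> E u w)"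

lemma simplicial_not_in_hole:
  assumes "simplicial v"
  shows "c4 E a b c d \<Longrightarrow> v \<notin> {a, b, c, d}" "c5 E a b c d e \<Longrightarrow> v \<notin> {a, b, c, d, e}"
    "c6 E a b c d e f \<Longrightarrow> v \<notin> {a, b, c, d, e, f}" "co_c6 E a b c d e f \<Longrightarrow> v \<notin> {a, b, c, d, e, f}"
proof -
  have nb: False if "E v u" "E v w" "\<not> E u w" "u \<noteq> w" for u w
    using assms that unfolding simplicial_def by blast
  show "v \<notin> {a, b, c, d}" if "c4 E a b c d"
    using that nb sym unfolding c4_def by blast
  show "v \<notin> {a, b, c, d, e}" if "c5 E a b c d e"
    using that nb sym distinct_hole(1)[OF that] unfolding c5_def by auto
  show "v \<notin> {a, b, c, d, e, f}" if "c6 E a b c d e f"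
    using that nb sym distinct_hole(2)[OF that] unfolding c6_def by auto
  show "v \<notin> {a, b, c, d, e, f}" if "co_c6 E a b c d e f"
    using that nb sym distinct_hole(3)[OF that] unfolding co_c6_def by auto
qed

lemma cosimplicial_not_in_antihole:
  assumes "cosimplicial v"
  shows "two_k2 E p q r s \<Longrightarrow> v \<notin> {p, q, r, s}" "co_c6 E a b c d e f \<Longrightarrow> v \<notin> {a, b, c, d, e, f}"
proof -
  have nonnb: False if "\<not> E v u" "\<not> E v w" "E u w" "u \<noteq> v" "w \<noteq> v" for u w
    using assms that in_V sym unfolding cosimplicial_def by blast
  show "v \<notin> {p, q, r, s}" if "two_k2 E p q r s"
    using that nonnb sym unfolding two_k2_def by blast
  show "v \<notin> {a, b, c, d, e, f}" if "co_c6 E a b c d e f"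
    using that nonnb sym distinct_hole(3)[OF that] unfolding co_c6_def by auto
qed

section \<open>The rules for each kind of basic graph\<close>

lemma wheel_antiwheel_free_of_c5:
  assumes c5: "c5 E a b c d e" and V: "V = {a, b, c, d, e}"
  shows "wheel_antiwheel_free V E"
proof
  have card: "card V = 5" using distinct_hole(1)[OF c5] V by simp
  \<comment> \<open>Naming the at most two neighbours instead of counting them makes three distinct
    neighbours a first-order contradiction.\<close>
  have "\<forall>v\<in>V. \<exists>x y. \<forall>t. E v t \<longrightarrow> t = x \<or> t = y"
    using c5 V sym irrefl in_V unfolding c5_def by (smt (verit) insert_iff empty_iff)
  then have deg: "\<exists>x y. \<forall>t. E v t \<longrightarrow> t = x \<or> t = y" for v using in_V by metis
  have codeg: "\<forall>v\<in>V. \<exists>x y. \<forall>t\<in>V. t \<noteq> v \<and> \<not> E v t \<longrightarrow> t = x \<or> t = y"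
    using c5 V sym irrefl in_V unfolding c5_def by (smt (verit) insert_iff empty_iff)
  show False if "c4 E a b c d" "E v a" "E v b" "E v c" for a b c d v
    using deg[of v] that irrefl unfolding c4_def by metis
  show False if "two_k2 E p q r s" "v \<in> V" "v \<noteq> r" "\<not> E v p" "\<not> E v q" "\<not> E v r" for p q r s v
    using codeg that irrefl sym in_V unfolding two_k2_def by metis
  show "V = {a, b, c, d, e}" if "c5 E a b c d e" for a b c d e
  proof -
    have "{a, b, c, d, e} \<subseteq> V" using that in_V unfolding c5_def by blast
    moreover have "card {a, b, c, d, e} = 5" using distinct_hole(1)[OF that] by simp
    ultimately show ?thesis using card_subset_eq[OF finite_V] card by metis
  qed
  have no6: False if "distinct [a, b, c, d, e, f]" "{a, b, c, d, e, f} \<subseteq> V" for a b c d e f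
  proof -
    have "card {a, b, c, d, e, f} = 6" using that(1) by simp
    then show False using card_mono[OF finite_V that(2)] card by simp
  qed
  show "V = {a, b, c, d, e, f}" if "c6 E a b c d e f" for a b c d e f
    using no6[OF distinct_hole(2)[OF that]] that in_V unfolding c6_def by blast
  show "V = {a, b, c, d, e, f}" if "co_c6 E a b c d e f" for a b c d e f
    using no6[OF distinct_hole(3)[OF that]] that in_V unfolding co_c6_def by blast
qed

lemma wheel_antiwheel_free_of_c6:
  assumes c6: "c6 E a b c d e f" and V: "V = {a, b, c, d, e, f}"
  shows "wheel_antiwheel_free V E"
proof
  have card: "card V = 6" using distinct_hole(2)[OF c6] V by simp
  have "\<forall>v\<in>V. \<exists>x y. \<forall>t. E v t \<longrightarrow> t = x \<or> t = y"
    using c6 V sym irrefl in_V unfolding c6_def by (smt (verit) insert_iff empty_iff)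
  then have deg: "\<exists>x y. \<forall>t. E v t \<longrightarrow> t = x \<or> t = y" for v using in_V by metis
  \<comment> \<open>The three non-neighbours of a vertex form a path. A violation of the 2K2 rule
    would make them \<open>p\<close>, \<open>q\<close>, \<open>r\<close>, where \<open>r\<close> is
    isolated.\<close>
  have codeg: "\<exists>x y z. (\<forall>t\<in>V. t \<noteq> v \<and> \<not> E v t \<longrightarrow> t = x \<or> t = y \<or> t = z) \<and> E x y \<and> E y z"
    if "v \<in> V" for v
  proof -
    let ?P = "\<lambda>a b c d e f. c6 E a b c d e f \<and> V = {a, b, c, d, e, f}"
    have rot: "?P b c d e f a" if "?P a b c d e f" for a b c d e f
      using that sym unfolding c6_def by blast
    have r0: "?P a b c d e f" using c6 V by blast
    note r1 = rot[OF r0] note r2 = rot[OF r1] note r3 = rot[OF r2] note r4 = rot[OF r3] note r5 = rot[OF r4]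
    from \<open>v \<in> V\<close> consider "v = a" | "v = b" | "v = c" | "v = d" | "v = e" | "v = f"
      using V by blast
    then have "\<exists>b c d e f. ?P v b c d e f"
    proof cases
      case 1 with r0 show ?thesis by metis
    next
      case 2 with r1 show ?thesis by metis
    next
      case 3 with r2 show ?thesis by metis
    next
      case 4 with r3 show ?thesis by metis
    next
      case 5 with r4 show ?thesis by metis
    next
      case 6 with r5 show ?thesis by metis
    qed
    then obtain b c d e f where "c6 E v b c d e f" "V = {v, b, c, d, e, f}" by blast
    then show ?thesis
      using sym unfolding c6_def by (intro exI[of _ c] exI[of _ d] exI[of _ e]) auto
  qed
  show False if "c4 E a b c d" "E v a" "E v b" "E v c" for a b c d v
    using deg[of v] that irrefl unfolding c4_def by metis
  show False if "two_k2 E p q r s" "v \<in> V" "v \<noteq> r" "\<not> E v p" "\<not> E v q" "\<not> E v r" for p q r s v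
  proof -
    obtain x y z where "\<forall>t\<in>V. t \<noteq> v \<and> \<not> E v t \<longrightarrow> t = x \<or> t = y \<or> t = z" "E x y" "E y z"
      using codeg[OF \<open>v \<in> V\<close>] by blast
    moreover have "p \<in> V" "q \<in> V" "r \<in> V" "p \<noteq> v" "q \<noteq> v" "r \<noteq> v" "p \<noteq> q" "p \<noteq> r" "q \<noteq> r" "\<not> E p r" "\<not> E q r"
      using that irrefl sym in_V unfolding two_k2_def by metis+
    ultimately show False using that sym by metis
  qed
  show "V = {a, b, c, d, e}" if "c5 E a b c d e" for a b c d e
  proof (rule ccontr)
    assume neq: "V \<noteq> {a, b, c, d, e}"
    have "{a, b, c, d, e} \<subseteq> V" using that in_V unfolding c5_def by blast
    with neq obtain v where v: "v \<in> V" "v \<notin> {a, b, c, d, e}" by blast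
    have "card {a, b, c, d, e} = 5" using distinct_hole(1)[OF that] by simp
    with v have "card (insert v {a, b, c, d, e}) = card V" using card by simp
    then have Veq: "V = insert v {a, b, c, d, e}"
      using card_subset_eq[OF finite_V, of "insert v {a, b, c, d, e}"] v \<open>{a, b, c, d, e} \<subseteq> V\<close> by simp
    \<comment> \<open>The sixth vertex has a neighbour \<open>x\<close> on the supposed 5-hole, and
      \<open>x\<close> would have degree three.\<close>
    have "\<exists>x. E v x"
      using v(1) c6 sym unfolding V c6_def by blast
    then obtain x where x: "E v x" "x \<in> {a, b, c, d, e}"
      using Veq in_V sym irrefl by blast
    then have "\<exists>y z. E x y \<and> E x z \<and> y \<noteq> z \<and> y \<in> {a, b, c, d, e} \<and> z \<in> {a, b, c, d, e}"
      using that distinct_hole(1)[OF that] sym unfolding c5_def by auto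
    then show False using deg[of x] sym[OF x(1)] v(2) by metis
  qed
  show "V = {a, b, c, d, e, f}" if "c6 E a b c d e f" for a b c d e f
  proof -
    have "{a, b, c, d, e, f} \<subseteq> V" using that in_V unfolding c6_def by blast
    moreover have "card {a, b, c, d, e, f} = 6" using distinct_hole(2)[OF that] by simp
    ultimately show ?thesis using card_subset_eq[OF finite_V] card by metis
  qed
  show "V = {a, b, c, d, e, f}" if "co_c6 E a b c d e f" for a b c d e f
  proof -
    have "E a c" "E a d" "E a e" "c \<noteq> d" "c \<noteq> e" "d \<noteq> e"
      using that distinct_hole(3)[OF that] sym unfolding co_c6_def by auto
    then show ?thesis using deg[of a] by metis
  qed
qed

text \<open>Every edge has an end in the clique \<open>K\<close>, whereas any vertex cover of a
  4-hole, a 2K2 or a 5-hole contains two non-adjacent vertices. The patterns on six vertices contain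
  one of these.\<close>

lemma wheel_antiwheel_free_of_split:
  assumes "adj_split V E"
  shows "wheel_antiwheel_free V E"
proof -
  obtain S K where V: "V = S \<union> K" and S: "\<forall>u\<in>S. \<forall>v\<in>S. \<not> E u v"
    and K: "\<forall>u\<in>K. \<forall>v\<in>K. u \<noteq> v \<longrightarrow> E u v"
    using assms unfolding adj_split_def by metis
  have side: "u \<in> K \<or> v \<in> K" if "E u v" for u v
    using S V in_V[OF that] in_V[OF sym[OF that]] that by blast
  have no_c4: "\<not> c4 E a b c d" for a b c d
    using side[of a b] side[of b c] side[of c d] side[of d a] K unfolding c4_def by blast
  moreover have no_2k2: "\<not> two_k2 E p q r s" for p q r s
  proof
    assume k: "two_k2 E p q r s"
    then have "p \<noteq> r" "p \<noteq> s" "q \<noteq> r" "q \<noteq> s"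
      using sym unfolding two_k2_def by blast+
    with k show False
      using side[of p q] side[of r s] K unfolding two_k2_def by blast
  qed
  moreover have "\<not> c5 E a b c d e" for a b c d e
    using side[of a b] side[of b c] side[of c d] side[of d e] side[of e a] K
      distinct_hole(1)[of a b c d e]
    unfolding c5_def by auto
  ultimately show ?thesis
    using c6_imp_two_k2 co_c6_imp_c4 by unfold_locales metis+
qed

text \<open>The neighbours of \<open>e\<close> form a clique, and the non-neighbours of
  \<open>c\<close>, as those of \<open>d\<close>, are stable. In the neighbourhood of a vertex of
  \<open>X\<close> every non-adjacent pair contains \<open>e\<close>. Hence 4-holes live in
  \<open>{a, b, c, d}\<close>, and 2K2s in the two anticomplete cliques \<open>{a, b}\<close> and
  \<open>insert e X\<close>.\<close>

lemma wheel_antiwheel_free_of_class_A: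
  assumes "adj_class_A V E"
  shows "wheel_antiwheel_free V E"
proof
  obtain a b c d e X where dist: "distinct [a, b, c, d, e]"
    and V: "V = {a, b, c, d, e} \<union> X" and c4: "c4 E a b c d"
    and cl: "\<forall>s\<in>X. \<forall>t\<in>X. s \<noteq> t \<longrightarrow> E s t"
    and X: "\<forall>s\<in>X. E s c \<and> E s d \<and> \<not> E s a \<and> \<not> E s b \<and> E e s"
    and e: "\<not> E e a" "\<not> E e b" "\<not> (E e c \<and> E e d)"
    using assms unfolding adj_class_A_def by (elim exE conjE) (rule that; assumption)
  have nb_e: "E e u \<Longrightarrow> u \<in> X \<or> u = c \<or> u = d" for u
    using e V in_V sym irrefl by blast
  have simp_e: "simplicial e"
    unfolding simplicial_def using nb_e cl X e sym by metis
  have nb_X: "E s u \<Longrightarrow> s \<in> X \<Longrightarrow> u \<in> X \<or> u = c \<or> u = d \<or> u = e" for s u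
    using X V in_V sym by blast
  have cosimp_c: "cosimplicial c"
    unfolding cosimplicial_def
  proof (intro ballI impI)
    fix u w assume "u \<in> V" "w \<in> V" "u \<noteq> c \<and> w \<noteq> c \<and> \<not> E c u \<and> \<not> E c w"
    then have "u \<in> {a, e}" "w \<in> {a, e}"
      using V X c4 sym unfolding c4_def by blast+
    then show "\<not> E u w" using e irrefl sym by blast
  qed
  have cosimp_d: "cosimplicial d"
    unfolding cosimplicial_def
  proof (intro ballI impI)
    fix u w assume "u \<in> V" "w \<in> V" "u \<noteq> d \<and> w \<noteq> d \<and> \<not> E d u \<and> \<not> E d w"
    then have "u \<in> {b, e}" "w \<in> {b, e}"
      using V X c4 sym unfolding c4_def by blast+
    then show "\<not> E u w" using e irrefl sym by blast
  qed
  note notin_e = simplicial_not_in_hole[OF simp_e]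
  have X_hole: "s \<notin> X" if "E s u" "E s w" "\<not> E u w" "u \<noteq> w" "u \<noteq> e" "w \<noteq> e" for s u w
  proof
    assume "s \<in> X"
    then show False
      using nb_X[OF that(1)] nb_X[OF that(2)] that c4 cl X sym unfolding c4_def by blast
  qed
  have c4_in: "{p, q, r, s} \<inter> (insert e X) = {}" if "c4 E p q r s" for p q r s
  proof -
    have "p \<notin> X" "q \<notin> X" "r \<notin> X" "s \<notin> X"
      using notin_e(1)[OF that] that X_hole[of p q s] X_hole[of q p r] X_hole[of r q s]
        X_hole[of s p r] sym
      unfolding c4_def by blast+
    then show ?thesis using notin_e(1)[OF that] by blast
  qed
  have clq: "E s t" if "s \<in> insert e X" "t \<in> insert e X" "s \<noteq> t" for s t
    using that cl X sym by blast
  show False if "c4 E p q r s" "E v p" "E v q" "E v r" for p q r s v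
  proof -
    have pqrs: "p \<in> {a, b, c, d}" "q \<in> {a, b, c, d}" "r \<in> {a, b, c, d}" "p \<noteq> q" "q \<noteq> r" "p \<noteq> r"
      using c4_in[OF that(1)] that in_V V irrefl unfolding c4_def by blast+
    have "E v a \<or> E v b" using that pqrs by blast
    then have "v \<in> {a, b, c, d}" using X e in_V V that by blast
    then show False using that pqrs c4 sym irrefl unfolding c4_def by blast
  qed
  have 2: "{p, q, r, s} \<subseteq> {a, b} \<union> insert e X" if "two_k2 E p q r s" for p q r s
  proof -
    have "{p, q, r, s} \<subseteq> V" using that in_V sym unfolding two_k2_def by blast
    then show ?thesis
      using cosimplicial_not_in_antihole(1)[OF cosimp_c that] cosimplicial_not_in_antihole(1)[OF cosimp_d that] V by blast
  qed
  show False if "two_k2 E p q r s" "v \<in> V" "v \<noteq> r" "\<not> E v p" "\<not> E v q" "\<not> E v r" for p q r s v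
  proof -
    have cases: "p \<in> {a, b} \<and> q \<in> {a, b} \<and> r \<in> insert e X \<and> s \<in> insert e X \<or>
        r \<in> {a, b} \<and> s \<in> {a, b} \<and> p \<in> insert e X \<and> q \<in> insert e X"
    proof -
      have "p \<noteq> r" "p \<noteq> s" "q \<noteq> r" "q \<noteq> s" "p \<noteq> q" "r \<noteq> s"
        using that(1) sym irrefl unfolding two_k2_def by blast+
      then show ?thesis
        using 2[OF that(1)] that(1) clq[of p r] clq[of p s] clq[of q r] clq[of q s] unfolding
          two_k2_def by auto
    qed
    have vp: "v \<noteq> p" "v \<noteq> q" "p \<noteq> q" using that sym irrefl unfolding two_k2_def by blast+
    show False
      using cases
    proof
      assume *: "p \<in> {a, b} \<and> q \<in> {a, b} \<and> r \<in> insert e X \<and> s \<in> insert e X"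
      then have "v \<in> insert e X"
        using vp that(2,4,5) V c4 sym unfolding c4_def by blast
      then show False using clq * that by blast
    next
      assume *: "r \<in> {a, b} \<and> s \<in> {a, b} \<and> p \<in> insert e X \<and> q \<in> insert e X"
      \<comment> \<open>Since \<open>p\<close> and \<open>q\<close> differ, one of them lies in
        \<open>X\<close> and is seen by \<open>c\<close> and \<open>d\<close>.\<close>
      then have "v \<notin> {c, d}" "v \<notin> insert e X"
        using vp that(4,5) X sym clq by blast+
      then have "v \<in> {a, b}" using V that(2) by blast
      then show False using * that c4 sym unfolding c4_def by blast
    qed
  qed
  have notX: "s \<notin> X" if "s = p \<or> s = q \<or> s = r \<or> s = t \<or> s = u" "c5 E p q r t u" for s p q r t u
    using that notin_e(2)[OF that(2)] X_hole[of p q u] X_hole[of q p r] X_hole[of r q t]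
      X_hole[of t r u] X_hole[of u t p]
      distinct_hole(1)[OF that(2)] sym unfolding c5_def by auto
  show "V = {p, q, r, t, u}" if "c5 E p q r t u" for p q r t u
  proof -
    have "{p, q, r, t, u} \<subseteq> {a, b, c, d}"
      using notX[OF _ that] notin_e(2)[OF that] that in_V V unfolding c5_def by blast
    from card_mono[OF _ this] have "card {p, q, r, t, u} \<le> 4" using dist by simp
    then show ?thesis using distinct_hole(1)[OF that] by simp
  qed
  show "V = {p, q, r, t, u, w}" if "c6 E p q r t u w" for p q r t u w
  proof -
    have "{p, q, r, t, u, w} \<inter> X = {}"
      using that notin_e(3)[OF that] X_hole[of p q w] X_hole[of q p r] X_hole[of r q t]
        X_hole[of t r u] X_hole[of u t w]
        X_hole[of w u p] distinct_hole(2)[OF that] sym unfolding c6_def by auto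
    moreover have "{p, q, r, t, u, w} \<subseteq> V"
      using that in_V unfolding c6_def by blast
    ultimately have "{p, q, r, t, u, w} \<subseteq> {a, b, c, d}"
      using notin_e(3)[OF that] V by blast
    from card_mono[OF _ this] have "card {p, q, r, t, u, w} \<le> 4" using dist by simp
    then show ?thesis using distinct_hole(2)[OF that] by simp
  qed
  show "V = {p, q, r, t, u, w}" if "co_c6 E p q r t u w" for p q r t u w
  proof -
    \<comment> \<open>The 4-hole \<open>p t q u\<close> of the prism avoids \<open>e\<close> and
      \<open>X\<close>, and the whole prism avoids \<open>c\<close> and \<open>d\<close>; so three
      distinct vertices would have to fit into \<open>{a, b}\<close>.\<close>
    have "{p, q, t} \<subseteq> V" using that in_V unfolding co_c6_def by blast
    then have "{p, q, t} \<subseteq> {a, b}"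
      using c4_in[OF co_c6_imp_c4[OF that]] V
        cosimplicial_not_in_antihole(2)[OF cosimp_c that] cosimplicial_not_in_antihole(2)[OF cosimp_d that] by blast
    then show ?thesis using distinct_hole(3)[OF that] by auto
  qed
qed

text \<open>Vertices of \<open>Z\<close> are simplicial, and without them all edges run between
  \<open>X\<close> and \<open>Y\<close>: this parity excludes 5-holes and the triangles in prisms
  and in wheels over 4-holes. The remaining rules hold because there is no 2K2 at all.\<close>

lemma wheel_antiwheel_free_of_class_B:
  assumes "adj_class_B V E"
  shows "wheel_antiwheel_free V E"
proof
  obtain X Y Z W x y where V: "V = X \<union> Y \<union> Z \<union> W"
    and disj: "X \<inter> Y = {}"
    and X: "\<forall>u\<in>X. \<forall>v\<in>X. \<not> E u v" and Y: "\<forall>u\<in>Y. \<forall>v\<in>Y. \<not> E u v"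
    and Z: "\<forall>u\<in>Z. \<forall>v\<in>Z. \<not> E u v" and W: "\<forall>u\<in>W. \<forall>v\<in>V. \<not> E u v"
    and xy: "x \<in> X" "y \<in> Y"
    and chain: "\<forall>p\<in>X. \<forall>r\<in>X. \<forall>q\<in>Y. \<forall>s\<in>Y. E p q \<and> E r s \<longrightarrow> E p s \<or> E r q"
    and x: "\<forall>v\<in>Y. E x v" and y: "\<forall>u\<in>X. E y u"
    and zxy: "\<forall>z\<in>Z. E z x \<and> E z y" and zXY: "\<forall>z\<in>Z. \<forall>v\<in>X \<union> Y - {x, y}. \<not> E z v"
    using assms unfolding adj_class_B_def by (elim exE conjE) (rule that; assumption)
  have nbZ: "v = x \<or> v = y" if "z \<in> Z" "E z v" for z v
    using that zXY Z W V in_V sym by blast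
  have edge: "p \<in> X \<and> q \<in> Y \<or> p \<in> Y \<and> q \<in> X \<or> p \<in> Z \<and> (q = x \<or> q = y) \<or> q \<in> Z \<and> (p = x \<or> p = y)"
    if "E p q" for p q
  proof -
    have pq: "p \<in> V" "q \<in> V" "E q p" using that in_V sym by blast+
    then have "p \<in> X \<union> Y \<union> Z" "q \<in> X \<union> Y \<union> Z" using W V that by blast+
    then show ?thesis
      using that pq X[rule_format, of p q] Y[rule_format, of p q] nbZ[of p q] nbZ[of q p] by blast
  qed
  have edge_XY: "p \<in> X \<longleftrightarrow> q \<notin> X" if "E p q" "p \<notin> Z" "q \<notin> Z" for p q
    using edge[OF that(1)] that disj by blast
  have nbx: "E x v" if "v \<in> Y \<union> Z" for v using that x zxy sym by blast
  have nby: "E y v" if "v \<in> X \<union> Z" for v using that y zxy sym by blast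
  have no_2k2: "\<not> two_k2 E p q r s" for p q r s
  proof
    assume k: "two_k2 E p q r s"
    \<comment> \<open>Every edge contains \<open>x\<close> or a neighbour of \<open>x\<close>, so
      \<open>x\<close> lies in no 2K2; the same holds for \<open>y\<close>.\<close>
    have "x \<notin> {p, q, r, s}" "y \<notin> {p, q, r, s}"
      using k edge[of p q] edge[of r s] nbx nby sym unfolding two_k2_def by blast+
    then show False
      using k edge[of p q] edge[of r s] chain sym unfolding two_k2_def by blast
  qed
  have simpZ: "simplicial z" if "z \<in> Z" for z
    unfolding simplicial_def using nbZ[OF that] x xy sym by metis
  show False if "c4 E p q r s" "E v p" "E v q" "E v r" for p q r s v
  proof -
    have "p \<notin> Z" "q \<notin> Z" "r \<notin> Z"
      using simplicial_not_in_hole(1)[OF simpZ that(1)] by blast+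
    moreover have "v \<notin> Z" using nbZ that irrefl unfolding c4_def by metis
    ultimately show False
      using edge_XY[OF that(2)] edge_XY[OF that(3)] edge_XY[of p q] that(1) unfolding c4_def by blast
  qed
  show False if "two_k2 E p q r s" for p q r s using no_2k2 that by blast
  show "V = {p, q, r, t, u}" if "c5 E p q r t u" for p q r t u
  proof -
    have "p \<notin> Z" "q \<notin> Z" "r \<notin> Z" "t \<notin> Z" "u \<notin> Z"
      using simplicial_not_in_hole(2)[OF simpZ that] by blast+
    then have False
      using edge_XY[of p q] edge_XY[of q r] edge_XY[of r t] edge_XY[of t u] edge_XY[of u p] that
      unfolding c5_def by metis
    then show ?thesis ..
  qed
  show "V = {p, q, r, t, u, w}" if "c6 E p q r t u w" for p q r t u w
    using c6_imp_two_k2[OF that] no_2k2 by blast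
  show "V = {p, q, r, t, u, w}" if "co_c6 E p q r t u w" for p q r t u w
  proof -
    have "p \<notin> Z" "r \<notin> Z" "u \<notin> Z"
      using simplicial_not_in_hole(4)[OF simpZ that] by blast+
    then have False
      using edge_XY[of p r] edge_XY[of r u] edge_XY[of u p] that unfolding co_c6_def by metis
    then show ?thesis ..
  qed
qed

text \<open>Non-adjacent vertices lie on different sides, so there is no stable triple, which
  settles 2K2s and 6-holes, and no odd cycle of non-edges, which settles 5-holes. A hub on a 4-hole
  would force two cross neighbours at one vertex, and a prism needs three cross edges.\<close>

lemma wheel_antiwheel_free_of_class_C:
  assumes "adj_class_C V E"
  shows "wheel_antiwheel_free V E"
proof
  obtain X Y x1 x2 y1 y2 where V: "V = X \<union> Y" "X \<inter> Y = {}"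
    and X: "\<forall>s\<in>X. \<forall>t\<in>X. s \<noteq> t \<longrightarrow> E s t" and Y: "\<forall>s\<in>Y. \<forall>t\<in>Y. s \<noteq> t \<longrightarrow> E s t"
    and ne: "x1 \<noteq> x2" "y1 \<noteq> y2"
    and XY: "\<forall>x\<in>X. \<forall>y\<in>Y. E x y \<longleftrightarrow> x = x1 \<and> y = y1 \<or> x = x2 \<and> y = y2"
    using assms unfolding adj_class_C_def by (elim exE conjE) (rule that; assumption)
  define side where "side v \<longleftrightarrow> v \<in> X" for v
  have same: "E s t" if "s \<in> V" "t \<in> V" "side s = side t" "s \<noteq> t" for s t
    using that X Y V unfolding side_def by blast
  have cross: "t = t'" if "E s t" "E s t'" "side s \<noteq> side t" "side s \<noteq> side t'" for s t t'
  proof -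
    have "s \<in> V" "t \<in> V" "t' \<in> V" using that in_V sym by blast+
    then have "s \<in> X \<and> t \<in> Y \<and> t' \<in> Y \<or> s \<in> Y \<and> t \<in> X \<and> t' \<in> X"
      using that V unfolding side_def by blast
    then show ?thesis
      using XY[rule_format, of s t] XY[rule_format, of s t'] XY[rule_format, of t s] XY[rule_format, of t' s]
        that sym ne by metis
  qed
  show False if "c4 E p q r s" "E v p" "E v q" "E v r" for p q r s v
    using that same[of p r] cross[of v q r] cross[of v p q] cross[of r q v] cross[of p q v] in_V
      sym irrefl
    unfolding c4_def by metis
  show False if "two_k2 E p q r s" "v \<in> V" "v \<noteq> r" "\<not> E v p" "\<not> E v q" "\<not> E v r" for p q r s v
    using that same[of v p] same[of v r] same[of p r] in_V sym irrefl unfolding two_k2_def by metis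
  show "V = {p, q, r, t, u}" if "c5 E p q r t u" for p q r t u
    using that same[of p r] same[of r u] same[of u q] same[of q t] same[of t p] in_V sym
      distinct_hole(1)[OF that] unfolding c5_def by (metis distinct_length_2_or_more)
  show "V = {p, q, r, t, u, w}" if "c6 E p q r t u w" for p q r t u w
    using that same[of p r] same[of r u] same[of p u] in_V sym
      distinct_hole(2)[OF that] unfolding c6_def by (metis distinct_length_2_or_more)
  show "V = {p, q, r, t, u, w}" if "co_c6 E p q r t u w" for p q r t u w
  proof -
    have d: "distinct [p, q, r, t, u, w]" by (rule distinct_hole(3)[OF that])
    have in_V': "p \<in> V" "q \<in> V" "r \<in> V" "t \<in> V" "u \<in> V" "w \<in> V"
      using that in_V unfolding co_c6_def by blast+
    have "side p \<noteq> side q" "side q \<noteq> side r" "side r \<noteq> side t" "side t \<noteq> side u" "side u \<noteq> side w"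
      using that same in_V' d unfolding co_c6_def by auto
    then have "p \<in> X \<and> r \<in> X \<and> u \<in> X \<and> q \<in> Y \<and> t \<in> Y \<and> w \<in> Y \<or> p \<in> Y \<and> r \<in> Y \<and> u \<in> Y \<and> q \<in> X \<and> t \<in> X \<and> w \<in> X"
      using V in_V' unfolding side_def by blast
    then show ?thesis
      using that d sym XY[rule_format, of p t] XY[rule_format, of r w] XY[rule_format, of u q]
        XY[rule_format, of t p] XY[rule_format, of w r] XY[rule_format, of q u]
      unfolding co_c6_def by auto
  qed
qed

lemma wheel_antiwheel_free_of_adj_basic: "adj_basic V E \<Longrightarrow> wheel_antiwheel_free V E"
  unfolding adj_basic_def
  using wheel_antiwheel_free_of_c5 wheel_antiwheel_free_of_c6 wheel_antiwheel_free_of_split wheel_antiwheel_free_of_class_A wheel_antiwheel_free_of_class_B wheel_antiwheel_free_of_class_C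
  by blast

theorem wheel_antiwheel_free_iff_adj_basic: "wheel_antiwheel_free V E \<longleftrightarrow> adj_basic V E \<or> adj_basic V (compl_adj V E)"
proof
  assume "adj_basic V E \<or> adj_basic V (compl_adj V E)"
  then show "wheel_antiwheel_free V E"
  proof
    assume "adj_basic V (compl_adj V E)"
    then have "wheel_antiwheel_free V (compl_adj V E)"
      by (rule sgraph.wheel_antiwheel_free_of_adj_basic[OF sgraph_compl_adj])
    from wheel_antiwheel_free.wheel_antiwheel_free_compl_adj[OF this] show ?thesis
      by (simp add: compl_adj_compl_adj)
  qed (rule wheel_antiwheel_free_of_adj_basic)
qed (rule wheel_antiwheel_free.adj_basic)

end

section \<open>Transfer to digraphs\<close>

lemma graph_imp_sgraph:
  assumes "graph G"
  shows "sgraph (verts G) (dominates G)"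
proof -
  interpret graph G by fact
  show ?thesis
    by unfold_locales (auto intro: graph_symmetric dest: adj_not_same adj_in_verts)
qed

lemma dominates_induce_iff: "u \<rightarrow>\<^bsub>G \<restriction> S\<^esub> v \<longleftrightarrow> u \<in> S \<and> v \<in> S \<and> u \<rightarrow>\<^bsub>G\<^esub> v"
  by (auto simp: arcs_ends_conv)

text \<open>Compatibility makes a subgraph inherit the \<open>head\<close> and \<open>tail\<close>
  functions, so as a record it is determined by its vertices.\<close>

lemma induced_subgraph_iff:
  assumes "wf_digraph G"
  shows "induced_subgraph H G \<longleftrightarrow> (\<exists>S \<subseteq> verts G. H = G \<restriction> S)"
proof
  assume H: "induced_subgraph H G"
  then have "compatible G H" by auto
  then have "H = G \<restriction> verts H"
    using H by (intro pre_digraph.equality) (auto simp: compatible_def)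
  moreover have "verts H \<subseteq> verts G" using H by auto
  ultimately show "\<exists>S \<subseteq> verts G. H = G \<restriction> S" by blast
next
  assume "\<exists>S \<subseteq> verts G. H = G \<restriction> S"
  then show "induced_subgraph H G"
    using wf_digraph.induced_induce[OF assms] by blast
qed

lemma free_of_iff: "wf_digraph G \<Longrightarrow> free_of F G \<longleftrightarrow> (\<forall>S \<subseteq> verts G. \<not> F (G \<restriction> S))"
  unfolding free_of_def by (auto simp: induced_subgraph_iff)

lemma graph_induce:
  assumes "graph G" "S \<subseteq> verts G"
  shows "graph (G \<restriction> S)"
proof -
  interpret graph G by fact
  have "induced_subgraph (G \<restriction> S) G" using assms(2) by (rule induced_induce)
  then have "digraph (G \<restriction> S)" "sym_digraph (G \<restriction> S)"
    using digraphI_induced induced_graph_imp_graph by blast+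
  then show ?thesis
    by (simp add: graph_def pseudo_graph_def digraph_def)
qed

lemma verts_complement: "verts (complement G) = verts G"
  by (simp add: complement_def)

lemma dominates_complement_iff: "u \<rightarrow>\<^bsub>complement G\<^esub> v \<longleftrightarrow> compl_adj (verts G) (dominates G) u v"
  by (auto simp: complement_def compl_adj_def)

lemma dominates_complement: "dominates (complement G) = compl_adj (verts G) (dominates G)"
  by (simp add: fun_eq_iff dominates_complement_iff)

lemma graph_complement:
  assumes "graph G"
  shows "graph (complement G)"
proof -
  interpret graph G by fact
  let ?H = "\<lparr>pverts = verts G, parcs = {(u, v). u \<in> verts G \<and> v \<in> verts G \<and> u \<noteq> v \<and> \<not> u \<rightarrow>\<^bsub>G\<^esub> v}\<rparr>"
  have "pair_graph ?H"
  proof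
    show "finite (parcs ?H)"
      by (rule finite_subset[of _ "verts G \<times> verts G"]) auto
    show "symmetric ?H"
      using graph_symmetric by (auto simp: symmetric_def intro: symI)
  qed auto
  then show ?thesis
    unfolding complement_def by (rule pair_graph.pair_graphD_graph)
qed

lemma complement_induce:
  assumes "S \<subseteq> verts G"
  shows "complement (G \<restriction> S) = complement G \<restriction> S"
  using assms
  by (intro pre_digraph.equality) (auto simp: complement_def dominates_induce_iff)

lemma induce_induce: "T \<subseteq> S \<Longrightarrow> (G \<restriction> S) \<restriction> T = G \<restriction> T"
  by (intro pre_digraph.equality) auto

section \<open>Isomorphisms as bijections and enumerations of vertices\<close>

lemma digraph_iso_with_proj_iff:
  assumes G: "graph G" and H: "pair_wf_digraph H"
  shows "digraph_iso G (with_proj H) \<longleftrightarrow>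
    (\<exists>f. bij_betw f (verts G) (pverts H) \<and>
       (\<forall>u\<in>verts G. \<forall>v\<in>verts G. u \<rightarrow>\<^bsub>G\<^esub> v \<longleftrightarrow> (f u, f v) \<in> parcs H))"
proof
  interpret graph G by fact
  {
    assume "digraph_iso G (with_proj H)"
    then obtain h where h: "digraph_isomorphism h" "with_proj H = app_iso h G"
      unfolding digraph_iso_def by blast
    have inj: "inj_on (iso_verts h) (verts G)"
      using h(1) by (rule digraph_isomorphism_inj_on_verts)
    have "pverts H = iso_verts h ` verts G"
      using arg_cong[OF h(2), of verts] by simp
    moreover have parcs: "parcs H = (\<lambda>(u, v). (iso_verts h u, iso_verts h v)) ` arcs_ends G"
      using arg_cong[OF h(2), of arcs_ends] arcs_ends_app_iso_eq[OF h(1)] by simp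
    moreover have "u \<rightarrow>\<^bsub>G\<^esub> v \<longleftrightarrow> (iso_verts h u, iso_verts h v) \<in> parcs H"
      if "u \<in> verts G" "v \<in> verts G" for u v
    proof
      assume "(iso_verts h u, iso_verts h v) \<in> parcs H"
      then obtain a b where "a \<rightarrow>\<^bsub>G\<^esub> b" "iso_verts h u = iso_verts h a" "iso_verts h v = iso_verts h b"
        unfolding parcs by auto
      then show "u \<rightarrow>\<^bsub>G\<^esub> v"
        using that inj by (metis adj_in_verts inj_onD)
    qed (auto simp: parcs)
    ultimately show "\<exists>f. bij_betw f (verts G) (pverts H) \<and>
       (\<forall>u\<in>verts G. \<forall>v\<in>verts G. u \<rightarrow>\<^bsub>G\<^esub> v \<longleftrightarrow> (f u, f v) \<in> parcs H)"
      using inj by (intro exI[of _ "iso_verts h"]) (auto simp: bij_betw_def)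
  next
    assume "\<exists>f. bij_betw f (verts G) (pverts H) \<and>
       (\<forall>u\<in>verts G. \<forall>v\<in>verts G. u \<rightarrow>\<^bsub>G\<^esub> v \<longleftrightarrow> (f u, f v) \<in> parcs H)"
    then obtain f where f: "bij_betw f (verts G) (pverts H)"
      "\<And>u v. \<lbrakk>u \<in> verts G; v \<in> verts G\<rbrakk> \<Longrightarrow> u \<rightarrow>\<^bsub>G\<^esub> v \<longleftrightarrow> (f u, f v) \<in> parcs H"
      by blast
    \<comment> \<open>The vertex map dictates the arc map: an arc goes to the pair of images of its
      ends. This is injective as there are no parallel arcs.\<close>
    let ?h = "\<lparr>iso_verts = f, iso_arcs = (\<lambda>e. (f (tail G e), f (head G e))), iso_head = snd, iso_tail = fst\<rparr>"
    have inj: "inj_on f (verts G)" using f(1) by (simp add: bij_betw_def)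
    have "digraph_isomorphism ?h"
      unfolding digraph_isomorphism_def
    proof (intro conjI ballI)
      show "wf_digraph G" by unfold_locales
      show "inj_on (iso_arcs ?h) (arcs G)"
        using inj no_multi_arcs by (auto simp: inj_on_def arc_to_ends_def)
    qed (use inj in auto)
    moreover have "(\<lambda>e. (f (tail G e), f (head G e))) ` arcs G = parcs H"
    proof (intro equalityI subsetI)
      fix e assume "e \<in> (\<lambda>e. (f (tail G e), f (head G e))) ` arcs G"
      then show "e \<in> parcs H"
        using f(2)[OF wellformed] by (auto simp: arcs_ends_conv)
    next
      fix e assume e: "e \<in> parcs H"
      then have "fst e \<in> f ` verts G" "snd e \<in> f ` verts G"
        using f(1) pair_wf_digraph.in_arcsD1[OF H] pair_wf_digraph.in_arcsD2[OF H] 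
        by (auto simp: bij_betw_def) (metis prod.collapse)+
      then obtain u v where uv: "u \<in> verts G" "v \<in> verts G" "e = (f u, f v)"
        by (metis imageE prod.collapse)
      then have "u \<rightarrow>\<^bsub>G\<^esub> v" using f(2) e by blast
      then show "e \<in> (\<lambda>e. (f (tail G e), f (head G e))) ` arcs G"
        using uv by (auto simp: arcs_ends_conv)
    qed
    ultimately have "with_proj H = app_iso ?h G"
      using f(1) by (intro pre_digraph.equality) (auto simp: bij_betw_def with_proj_def)
    with \<open>digraph_isomorphism ?h\<close> show "digraph_iso G (with_proj H)"
      unfolding digraph_iso_def by blast
  }
qed

lemma digraph_iso_list_iff:
  assumes "graph G" "pair_wf_digraph H" and H: "pverts H = {..<k}"
  shows "digraph_iso G (with_proj H) \<longleftrightarrow>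
    (\<exists>xs. length xs = k \<and> distinct xs \<and> set xs = verts G \<and>
       (\<forall>i<k. \<forall>j<k. xs ! i \<rightarrow>\<^bsub>G\<^esub> xs ! j \<longleftrightarrow> (i, j) \<in> parcs H))"
  unfolding digraph_iso_with_proj_iff[OF assms(1,2)] H
proof
  assume "\<exists>f. bij_betw f (verts G) {..<k} \<and>
    (\<forall>u\<in>verts G. \<forall>v\<in>verts G. u \<rightarrow>\<^bsub>G\<^esub> v \<longleftrightarrow> (f u, f v) \<in> parcs H)"
  then obtain f where f: "bij_betw f (verts G) {..<k}"
    "\<And>u v. \<lbrakk>u \<in> verts G; v \<in> verts G\<rbrakk> \<Longrightarrow> u \<rightarrow>\<^bsub>G\<^esub> v \<longleftrightarrow> (f u, f v) \<in> parcs H" by blast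
  define g where "g = inv_into (verts G) f"
  have g: "bij_betw g {..<k} (verts G)" unfolding g_def by (rule bij_betw_inv_into[OF f(1)])
  have fg: "f (g i) = i" if "i < k" for i
    using bij_betw_inv_into_right[OF f(1)] that by (simp add: g_def)
  have "g i \<in> verts G" if "i < k" for i using g that by (auto simp: bij_betw_def)
  then have "g i \<rightarrow>\<^bsub>G\<^esub> g j \<longleftrightarrow> (i, j) \<in> parcs H" if "i < k" "j < k" for i j
    using f(2)[of "g i" "g j"] that fg by simp
  then show "\<exists>xs. length xs = k \<and> distinct xs \<and> set xs = verts G \<and>
      (\<forall>i<k. \<forall>j<k. xs ! i \<rightarrow>\<^bsub>G\<^esub> xs ! j \<longleftrightarrow> (i, j) \<in> parcs H)"
    using g by (intro exI[of _ "map g [0..<k]"])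
      (auto simp: bij_betw_def distinct_map atLeast0LessThan[symmetric])
next
  assume "\<exists>xs. length xs = k \<and> distinct xs \<and> set xs = verts G \<and>
      (\<forall>i<k. \<forall>j<k. xs ! i \<rightarrow>\<^bsub>G\<^esub> xs ! j \<longleftrightarrow> (i, j) \<in> parcs H)"
  then obtain xs where xs: "length xs = k" "distinct xs" "set xs = verts G"
    "\<And>i j. \<lbrakk>i < k; j < k\<rbrakk> \<Longrightarrow> xs ! i \<rightarrow>\<^bsub>G\<^esub> xs ! j \<longleftrightarrow> (i, j) \<in> parcs H" by blast
  define f where "f = inv_into {..<k} ((!) xs)"
  have b: "bij_betw ((!) xs) {..<k} (verts G)"
    using bij_betw_nth[OF xs(2), of "{..<k}" "verts G"] xs by simp
  have f: "bij_betw f (verts G) {..<k}" unfolding f_def by (rule bij_betw_inv_into[OF b])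
  have "f u < k \<and> xs ! f u = u" if "u \<in> verts G" for u
    using that f bij_betw_inv_into_right[OF b that] by (auto simp: f_def bij_betw_def)
  then have "u \<rightarrow>\<^bsub>G\<^esub> v \<longleftrightarrow> (f u, f v) \<in> parcs H" if "u \<in> verts G" "v \<in> verts G" for u v
    using xs(4)[of "f u" "f v"] that by simp
  then show "\<exists>f. bij_betw f (verts G) {..<k} \<and>
    (\<forall>u\<in>verts G. \<forall>v\<in>verts G. u \<rightarrow>\<^bsub>G\<^esub> v \<longleftrightarrow> (f u, f v) \<in> parcs H)"
    using f by blast
qed

section \<open>Holes as cyclic lists of vertices\<close>

definition cyclic_adj :: "nat \<Rightarrow> nat \<Rightarrow> nat \<Rightarrow> bool" where
  "cyclic_adj k i j \<longleftrightarrow> j = Suc i mod k \<or> i = Suc j mod k"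

lemma is_hole_iff_list:
  "is_hole k G \<longleftrightarrow> graph G \<and> 4 \<le> k \<and> (\<exists>xs. length xs = k \<and> distinct xs \<and> set xs = verts G \<and>
     (\<forall>i<k. \<forall>j<k. xs ! i \<rightarrow>\<^bsub>G\<^esub> xs ! j \<longleftrightarrow> cyclic_adj k i j))"
proof -
  have "pair_wf_digraph (cycle_graph k)"
    by unfold_locales (auto simp: cycle_graph_def)
  then show ?thesis
    unfolding is_hole_def
    by (auto simp: digraph_iso_list_iff[of _ _ k] cycle_graph_def cyclic_adj_def)
qed

lemma is_hole_4_iff:
  assumes "graph G"
  shows "is_hole 4 G \<longleftrightarrow> (\<exists>a b c d. c4 (dominates G) a b c d \<and> verts G = {a, b, c, d})"
proof -
  interpret sgraph "verts G" "dominates G" using assms by (rule graph_imp_sgraph)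
  show ?thesis
  proof
    assume "is_hole 4 G"
    then obtain xs where xs: "length xs = 4" "distinct xs" "set xs = verts G"
      and adj: "\<And>i j. \<lbrakk>i < 4; j < 4\<rbrakk> \<Longrightarrow> xs ! i \<rightarrow>\<^bsub>G\<^esub> xs ! j \<longleftrightarrow> cyclic_adj 4 i j"
      unfolding is_hole_iff_list by blast
    obtain a b c d where xs_eq: "xs = [a, b, c, d]"
      using xs(1) by (auto simp: numeral_eq_Suc length_Suc_conv)
    have "c4 (dominates G) a b c d"
      using xs(2) adj[of 0 1] adj[of 0 2] adj[of 0 3] adj[of 1 2] adj[of 1 3] adj[of 2 3]
        adj[of 3 0] sym
      unfolding c4_def xs_eq by (auto simp: cyclic_adj_def)
    moreover have "verts G = {a, b, c, d}"
      using xs(3) xs_eq by simp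
    ultimately show "\<exists>a b c d. c4 (dominates G) a b c d \<and> verts G = {a, b, c, d}"
      by blast
  next
    assume "\<exists>a b c d. c4 (dominates G) a b c d \<and> verts G = {a, b, c, d}"
    then obtain a b c d where ck: "c4 (dominates G) a b c d" "verts G = {a, b, c, d}" by blast
    have "distinct [a, b, c, d]" using ck irrefl unfolding c4_def by auto
    moreover have "[a, b, c, d] ! i \<rightarrow>\<^bsub>G\<^esub> [a, b, c, d] ! j \<longleftrightarrow> cyclic_adj 4 i j" if "i < 4" "j < 4" for i j
    proof -
      have "i \<in> {0, 1, 2, 3}" "j \<in> {0, 1, 2, 3}" using that by auto
      then show ?thesis
        using ck(1) sym irrefl unfolding c4_def by (elim insertE emptyE) (simp_all add: cyclic_adj_def, blast+)
    qed
    ultimately show "is_hole 4 G"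
      using ck(2) assms unfolding is_hole_iff_list by (intro conjI exI[of _ "[a, b, c, d]"]) auto
  qed
qed

lemma is_hole_5_iff:
  assumes "graph G"
  shows "is_hole 5 G \<longleftrightarrow> (\<exists>a b c d e. c5 (dominates G) a b c d e \<and> verts G = {a, b, c, d, e})"
proof -
  interpret sgraph "verts G" "dominates G" using assms by (rule graph_imp_sgraph)
  show ?thesis
  proof
    assume "is_hole 5 G"
    then obtain xs where xs: "length xs = 5" "distinct xs" "set xs = verts G"
      and adj: "\<And>i j. \<lbrakk>i < 5; j < 5\<rbrakk> \<Longrightarrow> xs ! i \<rightarrow>\<^bsub>G\<^esub> xs ! j \<longleftrightarrow> cyclic_adj 5 i j"
      unfolding is_hole_iff_list by blast
    obtain a b c d e where xs_eq: "xs = [a, b, c, d, e]"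
      using xs(1) by (auto simp: numeral_eq_Suc length_Suc_conv)
    have "c5 (dominates G) a b c d e"
      using xs(2) adj[of 0 1] adj[of 0 2] adj[of 0 3] adj[of 0 4] adj[of 1 2] adj[of 1 3]
        adj[of 1 4] adj[of 2 3] adj[of 2 4] adj[of 3 4] adj[of 4 0] sym
      unfolding c5_def xs_eq by (auto simp: cyclic_adj_def)
    moreover have "verts G = {a, b, c, d, e}"
      using xs(3) xs_eq by simp
    ultimately show "\<exists>a b c d e. c5 (dominates G) a b c d e \<and> verts G = {a, b, c, d, e}"
      by blast
  next
    assume "\<exists>a b c d e. c5 (dominates G) a b c d e \<and> verts G = {a, b, c, d, e}"
    then obtain a b c d e where ck: "c5 (dominates G) a b c d e" "verts G = {a, b, c, d, e}" by blast
    have "distinct [a, b, c, d, e]" using ck(1) by (rule distinct_hole)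
    moreover have "[a, b, c, d, e] ! i \<rightarrow>\<^bsub>G\<^esub> [a, b, c, d, e] ! j \<longleftrightarrow> cyclic_adj 5 i j" if "i < 5" "j < 5" for i j
    proof -
      have "i \<in> {0, 1, 2, 3, 4}" "j \<in> {0, 1, 2, 3, 4}" using that by auto
      then show ?thesis
        using ck(1) sym irrefl unfolding c5_def by (elim insertE emptyE) (simp_all add: cyclic_adj_def, blast+)
    qed
    ultimately show "is_hole 5 G"
      using ck(2) assms unfolding is_hole_iff_list by (intro conjI exI[of _ "[a, b, c, d, e]"]) auto
  qed
qed

lemma is_hole_6_iff:
  assumes "graph G"
  shows "is_hole 6 G \<longleftrightarrow> (\<exists>a b c d e f. c6 (dominates G) a b c d e f \<and> verts G = {a, b, c, d, e, f})"
proof -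
  interpret sgraph "verts G" "dominates G" using assms by (rule graph_imp_sgraph)
  show ?thesis
  proof
    assume "is_hole 6 G"
    then obtain xs where xs: "length xs = 6" "distinct xs" "set xs = verts G"
      and adj: "\<And>i j. \<lbrakk>i < 6; j < 6\<rbrakk> \<Longrightarrow> xs ! i \<rightarrow>\<^bsub>G\<^esub> xs ! j \<longleftrightarrow> cyclic_adj 6 i j"
      unfolding is_hole_iff_list by blast
    obtain a b c d e f where xs_eq: "xs = [a, b, c, d, e, f]"
      using xs(1) by (auto simp: numeral_eq_Suc length_Suc_conv)
    have "c6 (dominates G) a b c d e f"
      using xs(2) adj[of 0 1] adj[of 0 2] adj[of 0 3] adj[of 0 4] adj[of 0 5] adj[of 1 2]
        adj[of 1 3] adj[of 1 4] adj[of 1 5] adj[of 2 3] adj[of 2 4] adj[of 2 5] adj[of 3 4]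
        adj[of 3 5] adj[of 4 5] adj[of 5 0] sym
      unfolding c6_def xs_eq by (auto simp: cyclic_adj_def)
    moreover have "verts G = {a, b, c, d, e, f}"
      using xs(3) xs_eq by simp
    ultimately show "\<exists>a b c d e f. c6 (dominates G) a b c d e f \<and> verts G = {a, b, c, d, e, f}"
      by blast
  next
    assume "\<exists>a b c d e f. c6 (dominates G) a b c d e f \<and> verts G = {a, b, c, d, e, f}"
    then obtain a b c d e f where ck: "c6 (dominates G) a b c d e f" "verts G = {a, b, c, d, e, f}" by blast
    have "distinct [a, b, c, d, e, f]" using ck(1) by (rule distinct_hole)
    moreover have "[a, b, c, d, e, f] ! i \<rightarrow>\<^bsub>G\<^esub> [a, b, c, d, e, f] ! j \<longleftrightarrow> cyclic_adj 6 i j" if "i < 6" "j < 6" for i j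
    proof -
      have "i \<in> {0, 1, 2, 3, 4, 5}" "j \<in> {0, 1, 2, 3, 4, 5}" using that by auto
      then show ?thesis
        using ck(1) sym irrefl unfolding c6_def by (elim insertE emptyE) (simp_all add: cyclic_adj_def, blast+)
    qed
    ultimately show "is_hole 6 G"
      using ck(2) assms unfolding is_hole_iff_list by (intro conjI exI[of _ "[a, b, c, d, e, f]"]) auto
  qed
qed

subsection \<open>The basic classes\<close>

lemma split_graph_iff:
  assumes "graph G"
  shows "split_graph G \<longleftrightarrow> adj_split (verts G) (dominates G)"
proof -
  have "verts G = S \<union> K \<and> S \<inter> K = {} \<and> stable G S \<and> clique G K \<longleftrightarrow>
    verts G = S \<union> K \<and> S \<inter> K = {} \<and>
    (\<forall>u\<in>S. \<forall>v\<in>S. \<not> u \<rightarrow>\<^bsub>G\<^esub> v) \<and> (\<forall>u\<in>K. \<forall>v\<in>K. u \<noteq> v \<longrightarrow> u \<rightarrow>\<^bsub>G\<^esub> v)" for S K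
    by (auto simp: stable_def clique_def)
  then show ?thesis
    unfolding split_graph_def adj_split_def using assms by simp
qed

lemma arcs_ends_induce_c4_iff:
  assumes "graph G" "distinct [a, b, c, d]"
  shows "arcs_ends (G \<restriction> {a, b, c, d}) = symcl {(a, b), (b, c), (c, d), (d, a)} \<longleftrightarrow> c4 (dominates G) a b c d"
proof -
  interpret sgraph "verts G" "dominates G" using assms(1) by (rule graph_imp_sgraph)
  show ?thesis
  proof
    assume eq: "arcs_ends (G \<restriction> {a, b, c, d}) = symcl {(a, b), (b, c), (c, d), (d, a)}"
    have iff: "u \<rightarrow>\<^bsub>G\<^esub> v \<longleftrightarrow> (u, v) \<in> symcl {(a, b), (b, c), (c, d), (d, a)}"
      if "u \<in> {a, b, c, d}" "v \<in> {a, b, c, d}" for u v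
      using dominates_induce_iff[of u v G "{a, b, c, d}"] that unfolding eq by blast
    show "c4 (dominates G) a b c d"
      using assms(2) unfolding c4_def by (auto simp: iff symcl_def)
  next
    assume c4: "c4 (dominates G) a b c d"
    then have "\<not> c \<rightarrow>\<^bsub>G\<^esub> a" "\<not> d \<rightarrow>\<^bsub>G\<^esub> b" using sym unfolding c4_def by blast+
    then have "(u, v) \<in> symcl {(a, b), (b, c), (c, d), (d, a)}"
      if "u \<in> {a, b, c, d}" "v \<in> {a, b, c, d}" "u \<rightarrow>\<^bsub>G\<^esub> v" for u v
      using that c4 irrefl unfolding c4_def
      by (elim insertE emptyE) (simp_all add: symcl_def)
    moreover have "(u, v) \<in> arcs_ends (G \<restriction> {a, b, c, d})"
      if "(u, v) \<in> symcl {(a, b), (b, c), (c, d), (d, a)}" for u v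
      using that c4 sym unfolding c4_def symcl_def by (auto simp: dominates_induce_iff)
    ultimately show "arcs_ends (G \<restriction> {a, b, c, d}) = symcl {(a, b), (b, c), (c, d), (d, a)}"
      using dominates_induce_iff[of _ _ G "{a, b, c, d}"] by (intro equalityI subrelI) blast+
  qed
qed

lemma class_A_iff:
  assumes "graph G"
  shows "class_A G \<longleftrightarrow> adj_class_A (verts G) (dominates G)"
proof -
  have card: "card {v \<in> {c, d}. P v} \<le> 1 \<longleftrightarrow> \<not> (P c \<and> P d)" if "c \<noteq> d" for c d :: 'a and P
  proof -
    have "{v \<in> {c, d}. P v} = (if P c then {c} else {}) \<union> (if P d then {d} else {})" by auto
    then show ?thesis using that by auto
  qed
  show ?thesis
  proof
    assume "class_A G"
    then obtain a b c d e X where dist: "distinct [a, b, c, d, e]"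
      and V: "verts G = {a, b, c, d, e} \<union> X" "{a, b, c, d, e} \<inter> X = {}"
      and hole: "arcs_ends (G \<restriction> {a, b, c, d}) = symcl {(a,b), (b,c), (c,d), (d,a)}"
      and X: "X \<noteq> {}" "clique G X" "complete_to G X {c, d}" "anticomplete_to G X {a, b}"
      and e: "complete_to G {e} X" "anticomplete_to G {e} {a, b}" "card {v \<in> {c, d}. e \<rightarrow>\<^bsub>G\<^esub> v} \<le> 1"
      unfolding class_A_def by (elim exE conjE) (rule that; assumption)
    have "c4 (dominates G) a b c d"
      using arcs_ends_induce_c4_iff[OF assms, of a b c d] dist hole by simp
    moreover have "\<forall>s\<in>X. \<forall>t\<in>X. s \<noteq> t \<longrightarrow> s \<rightarrow>\<^bsub>G\<^esub> t"
      "\<forall>s\<in>X. s \<rightarrow>\<^bsub>G\<^esub> c \<and> s \<rightarrow>\<^bsub>G\<^esub> d \<and> \<not> s \<rightarrow>\<^bsub>G\<^esub> a \<and> \<not> s \<rightarrow>\<^bsub>G\<^esub> b \<and> e \<rightarrow>\<^bsub>G\<^esub> s"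
      "\<not> e \<rightarrow>\<^bsub>G\<^esub> a" "\<not> e \<rightarrow>\<^bsub>G\<^esub> b"
      using X e by (auto simp: clique_def complete_to_def anticomplete_to_def)
    moreover have "\<not> (e \<rightarrow>\<^bsub>G\<^esub> c \<and> e \<rightarrow>\<^bsub>G\<^esub> d)"
      using card[of c d "dominates G e"] dist e(3) by simp
    ultimately show "adj_class_A (verts G) (dominates G)"
      unfolding adj_class_A_def using dist V X(1)
      by (intro exI[of _ a] exI[of _ b] exI[of _ c] exI[of _ d] exI[of _ e] exI[of _ X] conjI)
  next
    assume "adj_class_A (verts G) (dominates G)"
    then obtain a b c d e X where dist: "distinct [a, b, c, d, e]"
      and V: "verts G = {a, b, c, d, e} \<union> X" "{a, b, c, d, e} \<inter> X = {}" and c4: "c4 (dominates G) a b c d"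
      and ne: "X \<noteq> {}" and X: "\<forall>s\<in>X. \<forall>t\<in>X. s \<noteq> t \<longrightarrow> s \<rightarrow>\<^bsub>G\<^esub> t"
      "\<forall>s\<in>X. s \<rightarrow>\<^bsub>G\<^esub> c \<and> s \<rightarrow>\<^bsub>G\<^esub> d \<and> \<not> s \<rightarrow>\<^bsub>G\<^esub> a \<and> \<not> s \<rightarrow>\<^bsub>G\<^esub> b \<and> e \<rightarrow>\<^bsub>G\<^esub> s"
      and e: "\<not> e \<rightarrow>\<^bsub>G\<^esub> a" "\<not> e \<rightarrow>\<^bsub>G\<^esub> b" "\<not> (e \<rightarrow>\<^bsub>G\<^esub> c \<and> e \<rightarrow>\<^bsub>G\<^esub> d)"
      unfolding adj_class_A_def by (elim exE conjE) (rule that; assumption)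
    have "arcs_ends (G \<restriction> {a, b, c, d}) = symcl {(a,b), (b,c), (c,d), (d,a)}"
      using arcs_ends_induce_c4_iff[OF assms, of a b c d] dist c4 by simp
    moreover have "clique G X" "complete_to G X {c, d}" "anticomplete_to G X {a, b}"
      "complete_to G {e} X" "anticomplete_to G {e} {a, b}"
      using V X e by (auto simp: clique_def complete_to_def anticomplete_to_def)
    moreover have "card {v \<in> {c, d}. e \<rightarrow>\<^bsub>G\<^esub> v} \<le> 1"
      using card[of c d "dominates G e"] dist e(3) by simp
    ultimately show "class_A G"
      unfolding class_A_def using dist V ne assms
      by (intro conjI[OF assms] exI[of _ a] exI[of _ b] exI[of _ c] exI[of _ d] exI[of _ e]
        exI[of _ X] conjI)
  qed
qed

lemma class_C_iff:
  assumes "graph G"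
  shows "class_C G \<longleftrightarrow> adj_class_C (verts G) (dominates G)"
proof -
  interpret sgraph "verts G" "dominates G" using assms by (rule graph_imp_sgraph)
  show ?thesis
  proof
    assume "class_C G"
    then obtain X Y where V: "verts G = X \<union> Y" "X \<inter> Y = {}" and cl: "clique G X" "clique G Y"
      and M: "pairwise disjnt (edges_between G X Y)" "card (edges_between G X Y) = 2"
      unfolding class_C_def by blast
    obtain e1 e2 where e: "edges_between G X Y = {e1, e2}" "e1 \<noteq> e2"
      using M(2) by (auto simp: card_2_iff)
    then have "e1 \<in> edges_between G X Y" "e2 \<in> edges_between G X Y" by auto
    then obtain x1 y1 x2 y2 where xy: "e1 = {x1, y1}" "x1 \<in> X" "y1 \<in> Y" "e2 = {x2, y2}" "x2 \<in> X" "y2 \<in> Y"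
      unfolding edges_between_def by blast
    have "disjnt e1 e2" using M(1) e by (auto simp: pairwise_def)
    then have ne: "x1 \<noteq> x2" "y1 \<noteq> y2" using xy by (auto simp: disjnt_def)
    have "\<forall>x\<in>X. \<forall>y\<in>Y. x \<rightarrow>\<^bsub>G\<^esub> y \<longleftrightarrow> x = x1 \<and> y = y1 \<or> x = x2 \<and> y = y2"
    proof (intro ballI)
      fix x y assume that: "x \<in> X" "y \<in> Y"
      \<comment> \<open>As \<open>X\<close> and \<open>Y\<close> are disjoint, an unordered cross
        pair remembers which end lies on which side.\<close>
      have "x \<rightarrow>\<^bsub>G\<^esub> y \<longleftrightarrow> {x, y} \<in> edges_between G X Y"
        using that V(2) unfolding edges_between_def by (auto simp: doubleton_eq_iff)
      also have "\<dots> \<longleftrightarrow> x = x1 \<and> y = y1 \<or> x = x2 \<and> y = y2"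
        using that V(2) xy unfolding e by (auto simp: doubleton_eq_iff)
      finally show "x \<rightarrow>\<^bsub>G\<^esub> y \<longleftrightarrow> x = x1 \<and> y = y1 \<or> x = x2 \<and> y = y2" .
    qed
    moreover have "\<forall>s\<in>X. \<forall>t\<in>X. s \<noteq> t \<longrightarrow> s \<rightarrow>\<^bsub>G\<^esub> t" "\<forall>s\<in>Y. \<forall>t\<in>Y. s \<noteq> t \<longrightarrow> s \<rightarrow>\<^bsub>G\<^esub> t"
      using cl by (auto simp: clique_def)
    ultimately show "adj_class_C (verts G) (dominates G)"
      unfolding adj_class_C_def using V xy ne
      by (intro exI[of _ X] exI[of _ Y] exI[of _ x1] exI[of _ x2] exI[of _ y1] exI[of _ y2] conjI)
  next
    assume "adj_class_C (verts G) (dominates G)"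
    then obtain X Y x1 x2 y1 y2 where V: "verts G = X \<union> Y" "X \<inter> Y = {}"
      and cl: "\<forall>s\<in>X. \<forall>t\<in>X. s \<noteq> t \<longrightarrow> s \<rightarrow>\<^bsub>G\<^esub> t" "\<forall>s\<in>Y. \<forall>t\<in>Y. s \<noteq> t \<longrightarrow> s \<rightarrow>\<^bsub>G\<^esub> t"
      and xy: "x1 \<in> X" "x2 \<in> X" "x1 \<noteq> x2" "y1 \<in> Y" "y2 \<in> Y" "y1 \<noteq> y2"
      and XY: "\<forall>x\<in>X. \<forall>y\<in>Y. x \<rightarrow>\<^bsub>G\<^esub> y \<longleftrightarrow> x = x1 \<and> y = y1 \<or> x = x2 \<and> y = y2"
      unfolding adj_class_C_def by (elim exE conjE) (rule that; assumption)
    have fin: "finite X" "finite Y" using V finite_V by auto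
    have card: "2 \<le> card X" "2 \<le> card Y"
      using card_mono[OF fin(1), of "{x1, x2}"] card_mono[OF fin(2), of "{y1, y2}"] xy by auto
    have e: "edges_between G X Y = {{x1, y1}, {x2, y2}}"
    proof (intro equalityI subsetI)
      fix s assume "s \<in> edges_between G X Y"
      then obtain x y where "s = {x, y}" "x \<in> X" "y \<in> Y" "x \<rightarrow>\<^bsub>G\<^esub> y" unfolding edges_between_def by blast
      then show "s \<in> {{x1, y1}, {x2, y2}}" using XY by auto
    next
      fix s assume "s \<in> {{x1, y1}, {x2, y2}}"
      then show "s \<in> edges_between G X Y"
        unfolding edges_between_def using XY xy by auto
    qed
    have "disjnt {x1, y1} {x2, y2}" using xy V by (auto simp: disjnt_def)
    then have "pairwise disjnt (edges_between G X Y)" "card (edges_between G X Y) = 2"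
      using xy V unfolding e by (auto simp: pairwise_def disjnt_sym doubleton_eq_iff card_2_iff)
    moreover have "clique G X" "clique G Y"
      using cl V by (auto simp: clique_def)
    ultimately show "class_C G"
      unfolding class_C_def using V card
      by (intro conjI[OF assms] exI[of _ X] exI[of _ Y] conjI)
  qed
qed

section \<open>Induced paths on five vertices and the class B\<close>

lemma iso_path_graph_5_iff:
  assumes "graph G"
  shows "digraph_iso G (with_proj (path_graph 5)) \<longleftrightarrow> (\<exists>p q r s t. distinct [p, q, r, s, t] \<and>
     verts G = {p, q, r, s, t} \<and> p \<rightarrow>\<^bsub>G\<^esub> q \<and> q \<rightarrow>\<^bsub>G\<^esub> r \<and> r \<rightarrow>\<^bsub>G\<^esub> s \<and> s \<rightarrow>\<^bsub>G\<^esub> t \<and>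
     \<not> p \<rightarrow>\<^bsub>G\<^esub> r \<and> \<not> p \<rightarrow>\<^bsub>G\<^esub> s \<and> \<not> p \<rightarrow>\<^bsub>G\<^esub> t \<and> \<not> q \<rightarrow>\<^bsub>G\<^esub> s \<and> \<not> q \<rightarrow>\<^bsub>G\<^esub> t \<and> \<not> r \<rightarrow>\<^bsub>G\<^esub> t)"
  (is "_ \<longleftrightarrow> (\<exists>p q r s t. ?P p q r s t)")
proof -
  interpret sgraph "verts G" "dominates G" using assms by (rule graph_imp_sgraph)
  have wf: "pair_wf_digraph (path_graph 5)" "pverts (path_graph 5) = {..<5}"
    by (unfold_locales) (auto simp: path_graph_def)
  note iff = digraph_iso_list_iff[OF assms wf]
  show ?thesis
  proof
    assume "digraph_iso G (with_proj (path_graph 5))"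
    then obtain xs where xs: "length xs = 5" "distinct xs" "set xs = verts G"
      and adj: "\<And>i j. \<lbrakk>i < 5; j < 5\<rbrakk> \<Longrightarrow> xs ! i \<rightarrow>\<^bsub>G\<^esub> xs ! j \<longleftrightarrow> (i, j) \<in> parcs (path_graph 5)"
      unfolding iff by blast
    obtain p q r s t where xs_eq: "xs = [p, q, r, s, t]"
      using xs(1) by (auto simp: numeral_eq_Suc length_Suc_conv)
    have "?P p q r s t"
      using xs(2,3) adj[of 0 1] adj[of 0 2] adj[of 0 3] adj[of 0 4] adj[of 1 2] adj[of 1 3]
        adj[of 1 4]
        adj[of 2 3] adj[of 2 4] adj[of 3 4]
      unfolding xs_eq by (auto simp: path_graph_def)
    then show "\<exists>p q r s t. ?P p q r s t" by blast
  next
    assume "\<exists>p q r s t. ?P p q r s t"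
    then obtain p q r s t where P: "?P p q r s t" by blast
    have "[p, q, r, s, t] ! i \<rightarrow>\<^bsub>G\<^esub> [p, q, r, s, t] ! j \<longleftrightarrow> (i, j) \<in> parcs (path_graph 5)" if "i < 5" "j < 5" for i j
    proof -
      have "i \<in> {0, 1, 2, 3, 4}" "j \<in> {0, 1, 2, 3, 4}" using that by auto
      then show ?thesis
        using P sym irrefl by (elim insertE emptyE) (simp_all add: path_graph_def, blast+)
    qed
    then show "digraph_iso G (with_proj (path_graph 5))"
      unfolding iff using P by (intro exI[of _ "[p, q, r, s, t]"]) auto
  qed
qed

lemma class_B_imp_adj_class_B:
  assumes "class_B G"
  shows "adj_class_B (verts G) (dominates G)"
proof -
  have G: "graph G" using assms by (simp add: class_B_def)
  interpret sgraph "verts G" "dominates G" using G by (rule graph_imp_sgraph)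
  obtain X Y Z W x y where V: "verts G = X \<union> Y \<union> Z \<union> W"
    and disj: "X \<inter> Y = {}" "X \<inter> Z = {}" "X \<inter> W = {}" "Y \<inter> Z = {}" "Y \<inter> W = {}" "Z \<inter> W = {}"
    and st: "stable G X" "stable G Y" "stable G Z" "stable G W"
    and xy: "x \<in> X" "y \<in> Y" and card: "2 \<le> card X" "2 \<le> card Y"
    and P5: "free_of (\<lambda>H. digraph_iso H (with_proj (path_graph 5))) (G \<restriction> (X \<union> Y))"
    and W: "anticomplete_to G W (X \<union> Y \<union> Z)"
    and com: "complete_to G {x} Y" "complete_to G {y} X" "complete_to G Z {x, y}" "anticomplete_to G Z ((X \<union> Y) - {x, y})"
    using assms unfolding class_B_def by (elim exE conjE) (rule that; assumption)
  have chain: "\<forall>p\<in>X. \<forall>r\<in>X. \<forall>q\<in>Y. \<forall>s\<in>Y. p \<rightarrow>\<^bsub>G\<^esub> q \<and> r \<rightarrow>\<^bsub>G\<^esub> s \<longrightarrow> p \<rightarrow>\<^bsub>G\<^esub> s \<or> r \<rightarrow>\<^bsub>G\<^esub> q"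
  proof (intro ballI impI, rule ccontr)
    fix p r q s assume m: "p \<in> X" "r \<in> X" "q \<in> Y" "s \<in> Y" "p \<rightarrow>\<^bsub>G\<^esub> q \<and> r \<rightarrow>\<^bsub>G\<^esub> s"
      and n: "\<not> (p \<rightarrow>\<^bsub>G\<^esub> s \<or> r \<rightarrow>\<^bsub>G\<^esub> q)"
    \<comment> \<open>The vertex \<open>x\<close> sees \<open>q\<close> and \<open>s\<close> but
      neither \<open>p\<close> nor \<open>r\<close>, so it joins the two edges of a 2K2 to the
      induced path \<open>p q x s r\<close>.\<close>
    let ?S = "{p, q, x, s, r}"
    have S: "?S \<subseteq> X \<union> Y" "?S \<subseteq> verts G" using m xy V by auto
    have H: "graph (G \<restriction> ?S)" using S(2) by (rule graph_induce[OF G])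
    have stX: "\<not> u \<rightarrow>\<^bsub>G\<^esub> v" if "u \<in> X" "v \<in> X" for u v using st(1) that by (simp add: stable_def)
    have stY: "\<not> u \<rightarrow>\<^bsub>G\<^esub> v" if "u \<in> Y" "v \<in> Y" for u v using st(2) that by (simp add: stable_def)
    have x_adj: "x \<rightarrow>\<^bsub>G\<^esub> q" "x \<rightarrow>\<^bsub>G\<^esub> s" "q \<rightarrow>\<^bsub>G\<^esub> x"
      using com(1) m sym by (auto simp: complete_to_def)
    have "distinct [p, q, x, s, r]"
      using m n x_adj xy disj(1) by auto
    moreover have "s \<rightarrow>\<^bsub>G\<^esub> r" "\<not> q \<rightarrow>\<^bsub>G\<^esub> r" using m n sym by blast+
    ultimately have "digraph_iso (G \<restriction> ?S) (with_proj (path_graph 5))"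
      unfolding iso_path_graph_5_iff[OF H] dominates_induce_iff
      using m n x_adj stX stY xy
      by (intro exI[of _ p] exI[of _ q] exI[of _ x] exI[of _ s] exI[of _ r]) simp
    moreover have "(G \<restriction> (X \<union> Y)) \<restriction> ?S = G \<restriction> ?S" using S(1) by (rule induce_induce)
    moreover have wf: "wf_digraph (G \<restriction> (X \<union> Y))"
    proof -
      interpret graph G by (rule G)
      show ?thesis by (rule wellformed_induce_subgraph)
    qed
    have "\<not> digraph_iso ((G \<restriction> (X \<union> Y)) \<restriction> ?S) (with_proj (path_graph 5))"
      using P5 S(1) unfolding free_of_iff[OF wf] by (simp only: induce_subgraph_verts simp_thms)
    ultimately show False by simp
  qed
  have "X \<noteq> {x}" "Y \<noteq> {y}" using card by auto
  moreover have "\<forall>u\<in>W. \<forall>v\<in>verts G. \<not> u \<rightarrow>\<^bsub>G\<^esub> v"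
    using W st(4) V by (auto simp: anticomplete_to_def stable_def)
  moreover have "\<forall>u\<in>X. \<forall>v\<in>X. \<not> u \<rightarrow>\<^bsub>G\<^esub> v" "\<forall>u\<in>Y. \<forall>v\<in>Y. \<not> u \<rightarrow>\<^bsub>G\<^esub> v" "\<forall>u\<in>Z. \<forall>v\<in>Z. \<not> u \<rightarrow>\<^bsub>G\<^esub> v"
    using st by (auto simp: stable_def)
  moreover have "\<forall>v\<in>Y. x \<rightarrow>\<^bsub>G\<^esub> v" "\<forall>u\<in>X. y \<rightarrow>\<^bsub>G\<^esub> u" "\<forall>z\<in>Z. z \<rightarrow>\<^bsub>G\<^esub> x \<and> z \<rightarrow>\<^bsub>G\<^esub> y"
    "\<forall>z\<in>Z. \<forall>v\<in>X \<union> Y - {x, y}. \<not> z \<rightarrow>\<^bsub>G\<^esub> v"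
    using com by (auto simp: complete_to_def anticomplete_to_def)
  ultimately show ?thesis
    unfolding adj_class_B_def using V disj xy chain
    by (intro exI[of _ X] exI[of _ Y] exI[of _ Z] exI[of _ W] exI[of _ x] exI[of _ y] conjI)
qed

lemma adj_class_B_imp_class_B:
  assumes G: "graph G" and B: "adj_class_B (verts G) (dominates G)"
  shows "class_B G"
proof -
  interpret sgraph "verts G" "dominates G" using G by (rule graph_imp_sgraph)
  obtain X Y Z W x y where V: "verts G = X \<union> Y \<union> Z \<union> W"
    and disj: "X \<inter> Y = {}" "X \<inter> Z = {}" "X \<inter> W = {}" "Y \<inter> Z = {}" "Y \<inter> W = {}" "Z \<inter> W = {}"
    and X: "\<forall>u\<in>X. \<forall>v\<in>X. \<not> u \<rightarrow>\<^bsub>G\<^esub> v" and Y: "\<forall>u\<in>Y. \<forall>v\<in>Y. \<not> u \<rightarrow>\<^bsub>G\<^esub> v"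
    and Z: "\<forall>u\<in>Z. \<forall>v\<in>Z. \<not> u \<rightarrow>\<^bsub>G\<^esub> v" and W: "\<forall>u\<in>W. \<forall>v\<in>verts G. \<not> u \<rightarrow>\<^bsub>G\<^esub> v"
    and xy: "x \<in> X" "y \<in> Y" and ne: "X \<noteq> {x}" "Y \<noteq> {y}"
    and chain: "\<forall>p\<in>X. \<forall>r\<in>X. \<forall>q\<in>Y. \<forall>s\<in>Y. p \<rightarrow>\<^bsub>G\<^esub> q \<and> r \<rightarrow>\<^bsub>G\<^esub> s \<longrightarrow> p \<rightarrow>\<^bsub>G\<^esub> s \<or> r \<rightarrow>\<^bsub>G\<^esub> q"
    and x: "\<forall>v\<in>Y. x \<rightarrow>\<^bsub>G\<^esub> v" and y: "\<forall>u\<in>X. y \<rightarrow>\<^bsub>G\<^esub> u"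
    and zxy: "\<forall>z\<in>Z. z \<rightarrow>\<^bsub>G\<^esub> x \<and> z \<rightarrow>\<^bsub>G\<^esub> y" and zXY: "\<forall>z\<in>Z. \<forall>v\<in>X \<union> Y - {x, y}. \<not> z \<rightarrow>\<^bsub>G\<^esub> v"
    using B unfolding adj_class_B_def by (elim exE conjE) (rule that; assumption)
  let ?H = "G \<restriction> (X \<union> Y)"
  have XY: "X \<union> Y \<subseteq> verts G" using V by blast
  have H: "graph ?H" using XY by (rule graph_induce[OF G])
  have fin: "finite X" "finite Y" using XY finite_V by (auto intro: finite_subset)
  have card2: "2 \<le> card A" if A: "finite A" "a \<in> A" "A \<noteq> {a}" for A and a :: 'a
  proof -
    obtain b where "b \<in> A" "b \<noteq> a" using A by blast
    then have "card {a, b} \<le> card A" using A by (intro card_mono) auto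
    then show ?thesis using \<open>b \<noteq> a\<close> by simp
  qed
  have "connected ?H"
  proof -
    interpret H: graph ?H by (rule H)
    have to_x: "u \<rightarrow>\<^sup>*\<^bsub>?H\<^esub> x" "x \<rightarrow>\<^sup>*\<^bsub>?H\<^esub> u" if "u \<in> X \<union> Y" for u
    proof -
      have Y_adj: "v \<rightarrow>\<^bsub>?H\<^esub> x" "x \<rightarrow>\<^bsub>?H\<^esub> v" if "v \<in> Y" for v
        using that x xy sym by (auto simp: dominates_induce_iff)
      have X_adj: "v \<rightarrow>\<^bsub>?H\<^esub> y" "y \<rightarrow>\<^bsub>?H\<^esub> v" if "v \<in> X" for v
        using that y xy sym by (auto simp: dominates_induce_iff)
      have "u \<rightarrow>\<^sup>*\<^bsub>?H\<^esub> x \<and> x \<rightarrow>\<^sup>*\<^bsub>?H\<^esub> u"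
      proof (cases "u \<in> Y")
        case True
        then show ?thesis using Y_adj H.reachable_adjI by blast
      next
        case False
        then have "u \<in> X" using that by blast
        then show ?thesis
          using X_adj[of u] Y_adj[OF xy(2)] H.adj_reachable_trans H.reachable_adjI by blast
      qed
      then show "u \<rightarrow>\<^sup>*\<^bsub>?H\<^esub> x" "x \<rightarrow>\<^sup>*\<^bsub>?H\<^esub> u" by blast+
    qed
    have "u \<rightarrow>\<^sup>*\<^bsub>?H\<^esub> v" if "u \<in> X \<union> Y" "v \<in> X \<union> Y" for u v
      using to_x(1)[OF that(1)] to_x(2)[OF that(2)] by (rule H.reachable_trans)
    moreover have "symcl (arcs_ends ?H) = arcs_ends ?H"
      using H.graph_symmetric by (auto simp: symcl_def)
    ultimately show ?thesis
      using xy by (auto simp: connected_conv reachable_def)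
  qed
  moreover have "bipartite ?H"
    unfolding bipartite_def stable_def using H X Y disj(1)
    by (intro conjI exI[of _ X] exI[of _ Y]) (auto simp: dominates_induce_iff)
  moreover have "free_of (\<lambda>H. digraph_iso H (with_proj (path_graph 5))) ?H"
  proof -
    have "wf_digraph ?H"
    proof -
      interpret graph G by (rule G)
      show ?thesis by (rule wellformed_induce_subgraph)
    qed
    moreover have False if S: "S \<subseteq> X \<union> Y" and iso: "digraph_iso (?H \<restriction> S) (with_proj (path_graph 5))" for S
    proof -
      have S': "S \<subseteq> verts G" using S XY by blast
      obtain p q r s t where P: "S = {p, q, r, s, t}" "p \<rightarrow>\<^bsub>G\<^esub> q" "q \<rightarrow>\<^bsub>G\<^esub> r" "r \<rightarrow>\<^bsub>G\<^esub> s" "s \<rightarrow>\<^bsub>G\<^esub> t"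
        "\<not> p \<rightarrow>\<^bsub>G\<^esub> s" "\<not> q \<rightarrow>\<^bsub>G\<^esub> t"
        using iso unfolding induce_induce[OF S] iso_path_graph_5_iff[OF graph_induce[OF G S']] dominates_induce_iff
        by auto
      have alt: "u \<in> X \<longleftrightarrow> v \<in> Y" if "u \<in> S" "v \<in> S" "u \<rightarrow>\<^bsub>G\<^esub> v" for u v
        using that S X Y disj(1) by blast
      have m: "p \<in> S" "q \<in> S" "r \<in> S" "s \<in> S" "t \<in> S" using P(1) by auto
      have side: "u \<in> X \<or> u \<in> Y" if "u \<in> S" for u using that S by blast
      have "q \<rightarrow>\<^bsub>G\<^esub> p" "t \<rightarrow>\<^bsub>G\<^esub> s" "\<not> s \<rightarrow>\<^bsub>G\<^esub> p" "\<not> t \<rightarrow>\<^bsub>G\<^esub> q" using P sym by blast+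
      \<comment> \<open>The end edges \<open>pq\<close> and \<open>st\<close> of the path form a
        2K2, and alternation of the sides orients them as the chain condition requires.\<close>
      consider "p \<in> X" "q \<in> Y" "s \<in> Y" "t \<in> X" | "p \<in> Y" "q \<in> X" "s \<in> X" "t \<in> Y"
        using alt[OF m(1,2) P(2)] alt[OF m(2,3) P(3)] alt[OF m(3,4) P(4)] alt[OF m(4,5) P(5)]
          side[OF m(1)] side[OF m(2)] side[OF m(3)] side[OF m(4)] side[OF m(5)] disj(1) by blast
      then show False
        using chain P \<open>q \<rightarrow>\<^bsub>G\<^esub> p\<close> \<open>t \<rightarrow>\<^bsub>G\<^esub> s\<close> \<open>\<not> s \<rightarrow>\<^bsub>G\<^esub> p\<close> \<open>\<not> t \<rightarrow>\<^bsub>G\<^esub> q\<close> by cases blast+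
    qed
    ultimately show ?thesis by (auto simp: free_of_iff)
  qed
  moreover have "stable G X" "stable G Y" "stable G Z" "stable G W"
    using X Y Z W V by (auto simp: stable_def)
  moreover have "2 \<le> card X" "2 \<le> card Y"
    using card2 fin xy ne by blast+
  moreover have "anticomplete_to G W (X \<union> Y \<union> Z)"
    using W V by (auto simp: anticomplete_to_def)
  moreover have "complete_to G {x} Y" "complete_to G {y} X" "complete_to G Z {x, y}" "anticomplete_to G Z ((X \<union> Y) - {x, y})"
    using x y zxy zXY by (auto simp: complete_to_def anticomplete_to_def)
  ultimately show ?thesis
    unfolding class_B_def using G V disj xy
    by (intro exI[of _ X] exI[of _ Y] exI[of _ Z] exI[of _ W] exI[of _ x] exI[of _ y] conjI)
qed

lemma basic_iff:
  assumes "graph G"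
  shows "basic G \<longleftrightarrow> adj_basic (verts G) (dominates G)"
  unfolding basic_def adj_basic_def is_hole_5_iff[OF assms] is_hole_6_iff[OF assms]
    split_graph_iff[OF assms] class_A_iff[OF assms] class_C_iff[OF assms]
  using class_B_imp_adj_class_B adj_class_B_imp_class_B[OF assms] by blast

subsection \<open>Wheels and antiwheels\<close>

definition no_small_wheel :: "('a, 'b) pre_digraph \<Rightarrow> bool" where
  "no_small_wheel G \<longleftrightarrow> (\<forall>S \<subseteq> verts G. card S \<le> 7 \<longrightarrow> \<not> is_wheel (G \<restriction> S))"

text \<open>The bound six on the hole leaves room for the hub among seven vertices.\<close>

lemma no_small_wheelD:
  assumes G: "graph G" and nw: "no_small_wheel G" and S: "S \<subseteq> verts G" "card S \<le> 6"
    and hole: "is_hole k (G \<restriction> S)" and h: "h \<in> verts G" "h \<notin> S"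
  shows "card {v \<in> S. h \<rightarrow>\<^bsub>G\<^esub> v} \<le> 2"
proof (rule ccontr)
  assume large: "\<not> ?thesis"
  let ?H = "G \<restriction> insert h S"
  have sub: "insert h S \<subseteq> verts G" using S h by blast
  have "finite S" using S(1) graph_imp_sgraph[OF G] sgraph.finite_V finite_subset by blast
  then have "card (insert h S) \<le> 7" using S(2) h by simp
  moreover have "is_wheel ?H"
    unfolding is_wheel_def
  proof (intro conjI bexI[of _ h])
    show "graph ?H" using sub by (rule graph_induce[OF G])
    have S_eq: "verts ?H - {h} = S" using h by auto
    have "?H \<restriction> S = G \<restriction> S" by (rule induce_induce) blast
    then show "\<exists>k. is_hole k (?H \<restriction> (verts ?H - {h}))" using hole S_eq by auto
    have "{v \<in> S. h \<rightarrow>\<^bsub>?H\<^esub> v} = {v \<in> S. h \<rightarrow>\<^bsub>G\<^esub> v}" by (auto simp: dominates_induce_iff)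
    then show "3 \<le> card {v \<in> verts ?H - {h}. h \<rightarrow>\<^bsub>?H\<^esub> v}"
      using large unfolding S_eq by simp
  qed simp
  ultimately show False using nw sub unfolding no_small_wheel_def by blast
qed

lemma c4_rule_of_no_small_wheel:
  assumes G: "graph G" and nw: "no_small_wheel G" and c4: "c4 (dominates G) a b c d"
    and v: "v \<rightarrow>\<^bsub>G\<^esub> a" "v \<rightarrow>\<^bsub>G\<^esub> b" "v \<rightarrow>\<^bsub>G\<^esub> c"
  shows False
proof -
  interpret sgraph "verts G" "dominates G" using G by (rule graph_imp_sgraph)
  let ?S = "{a, b, c, d}"
  have S: "?S \<subseteq> verts G" using c4 in_V sym unfolding c4_def by blast
  have dist: "distinct [a, b, c, d]" using c4 irrefl unfolding c4_def by auto
  have "is_hole 4 (G \<restriction> ?S)"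
    unfolding is_hole_4_iff[OF graph_induce[OF G S]]
    using c4 by (intro exI[of _ a] exI[of _ b] exI[of _ c] exI[of _ d]) (simp add: c4_def dominates_induce_iff)
  moreover have "v \<in> verts G" "v \<notin> ?S"
    using v in_V c4 irrefl sym unfolding c4_def by blast+
  moreover have "card ?S \<le> 6" using dist by simp
  ultimately have "card {x \<in> ?S. v \<rightarrow>\<^bsub>G\<^esub> x} \<le> 2"
    using no_small_wheelD[OF G nw S] by blast
  moreover have "card {a, b, c} \<le> card {x \<in> ?S. v \<rightarrow>\<^bsub>G\<^esub> x}"
    using v by (intro card_mono) auto
  ultimately show False using dist by simp
qed

lemma c5_rule_of_no_small_wheel:
  assumes G: "graph G" and nw: "no_small_wheel G" and c5: "c5 (dominates G) a b c d e"
    and v: "v \<in> verts G" "v \<notin> {a, b, c, d, e}"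
  shows "card {x \<in> {a, b, c, d, e}. v \<rightarrow>\<^bsub>G\<^esub> x} \<le> 2"
proof -
  interpret sgraph "verts G" "dominates G" using G by (rule graph_imp_sgraph)
  have S: "{a, b, c, d, e} \<subseteq> verts G" using c5 in_V unfolding c5_def by blast
  have "is_hole 5 (G \<restriction> {a, b, c, d, e})"
    unfolding is_hole_5_iff[OF graph_induce[OF G S]]
    using c5 by (intro exI[of _ a] exI[of _ b] exI[of _ c] exI[of _ d] exI[of _ e]) (simp add: c5_def dominates_induce_iff)
  moreover have "card {a, b, c, d, e} \<le> 6" using distinct_hole(1)[OF c5] by simp
  ultimately show ?thesis using no_small_wheelD[OF G nw S] v by blast
qed

text \<open>Wheel-freeness allows an outside vertex at most two neighbours on the 6-hole, whereas
  the 2K2 rule demands at least three. That rule is a hypothesis so that the lemma serves for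
  \<open>G\<close> and for its complement.\<close>

lemma c6_rule_of_no_small_wheel:
  assumes G: "graph G" and nw: "no_small_wheel G" and c6: "c6 (dominates G) a b c d e f"
    and two_k2: "\<And>p q r s v. \<lbrakk>two_k2 (dominates G) p q r s; v \<in> verts G; v \<noteq> r;
      \<not> v \<rightarrow>\<^bsub>G\<^esub> p; \<not> v \<rightarrow>\<^bsub>G\<^esub> q; \<not> v \<rightarrow>\<^bsub>G\<^esub> r\<rbrakk> \<Longrightarrow> False"
  shows "verts G = {a, b, c, d, e, f}"
proof (rule ccontr)
  interpret sgraph "verts G" "dominates G" using G by (rule graph_imp_sgraph)
  let ?S = "{a, b, c, d, e, f}"
  assume "verts G \<noteq> ?S"
  moreover have S: "?S \<subseteq> verts G" using c6 in_V unfolding c6_def by blast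
  ultimately obtain v where v: "v \<in> verts G" "v \<notin> ?S" by blast
  have dist: "distinct [a, b, c, d, e, f]" using distinct_hole(2)[OF c6] .
  have "is_hole 6 (G \<restriction> ?S)"
    unfolding is_hole_6_iff[OF graph_induce[OF G S]]
    using c6 by (intro exI[of _ a] exI[of _ b] exI[of _ c] exI[of _ d] exI[of _ e] exI[of _ f])
      (simp add: c6_def dominates_induce_iff)
  moreover have "card ?S \<le> 6" using dist by simp
  ultimately have le: "card {x \<in> ?S. v \<rightarrow>\<^bsub>G\<^esub> x} \<le> 2"
    using no_small_wheelD[OF G nw S] v by blast
  define n where "n x = (if v \<rightarrow>\<^bsub>G\<^esub> x then 1 else 0 :: nat)" for x
  have ge: "2 \<le> n p + n q + n r + n s"
    if k: "two_k2 (dominates G) p q r s" and m: "{p, q, r, s} \<subseteq> ?S" for p q r s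
  proof -
    have "v \<notin> {p, q, r, s}" using m v by blast
    moreover have "two_k2 (dominates G) p q s r" "two_k2 (dominates G) r s p q" "two_k2 (dominates G) r s q p"
      using k sym unfolding two_k2_def by blast+
    ultimately show ?thesis
      using two_k2[OF k v(1)] two_k2[of p q s r v] two_k2[of r s p q v] two_k2[of r s q p v] v(1)
      unfolding n_def by auto
  qed
  \<comment> \<open>Each pair of opposite edges of the 6-hole is a 2K2. The three inequalities count
    every vertex twice, so their sum gives at least three neighbours.\<close>
  have "2 \<le> n a + n b + n d + n e" "2 \<le> n b + n c + n e + n f" "2 \<le> n c + n d + n f + n a"
    using c6 sym by (intro ge; auto simp: two_k2_def c6_def)+
  moreover have "card {x \<in> ?S. v \<rightarrow>\<^bsub>G\<^esub> x} = (\<Sum>x\<in>?S. n x)"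
    unfolding n_def by (simp add: sum.If_cases Int_def)
  moreover have "(\<Sum>x\<in>?S. n x) = n a + n b + n c + n d + n e + n f"
    using dist by simp
  ultimately show False using le by linarith
qed

lemma wheel_antiwheel_free_of_no_small_wheel:
  assumes G: "graph G" and nw: "no_small_wheel G" "no_small_wheel (complement G)"
  shows "wheel_antiwheel_free (verts G) (dominates G)"
proof -
  interpret sgraph "verts G" "dominates G" using G by (rule graph_imp_sgraph)
  let ?E = "dominates G" and ?C = "compl_adj (verts G) (dominates G)"
  note GC = graph_complement[OF G]
  interpret C: sgraph "verts G" ?C by (rule sgraph_compl_adj)
  have compl: "v \<in> verts G \<Longrightarrow> x \<in> verts G \<Longrightarrow> v \<noteq> x \<Longrightarrow> ?C v x \<longleftrightarrow> \<not> ?E v x" for v x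
    by (simp add: compl_adj_def)
  have two_k2: False if k: "two_k2 ?E p q r s" and v: "v \<in> verts G" "v \<noteq> r" "\<not> ?E v p" "\<not> ?E v q" "\<not> ?E v r" for p q r s v
  proof -
    have "v \<noteq> p" "v \<noteq> q" "p \<in> verts G" "q \<in> verts G" "r \<in> verts G"
      using k v in_V sym unfolding two_k2_def by blast+
    then have "?C v p" "?C v r" "?C v q" using v compl by auto
    then show False
      using c4_rule_of_no_small_wheel[OF GC nw(2), of p r q s v] c4_compl_adj_of_two_k2[OF k]
      unfolding dominates_complement dominates_complement_iff by blast
  qed
  have two_k2_C: False if k: "two_k2 ?C p q r s" and v: "v \<in> verts G" "v \<noteq> r" "\<not> ?C v p" "\<not> ?C v q" "\<not> ?C v r" for p q r s v
  proof -
    have "v \<noteq> p" "v \<noteq> q" "p \<in> verts G" "q \<in> verts G" "r \<in> verts G"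
      using k v C.in_V C.sym unfolding two_k2_def by blast+
    then have "?E v p" "?E v r" "?E v q" using v compl by auto
    then show False
      using c4_rule_of_no_small_wheel[OF G nw(1), of p r q s v] two_k2_compl_adj[OF k] by blast
  qed
  show ?thesis
  proof
    show False if "c4 ?E a b c d" "?E v a" "?E v b" "?E v c" for a b c d v
      using c4_rule_of_no_small_wheel[OF G nw(1)] that by blast
    show False if "two_k2 ?E p q r s" "v \<in> verts G" "v \<noteq> r" "\<not> ?E v p" "\<not> ?E v q" "\<not> ?E v r" for p q r s v
      using two_k2 that by blast
    show "verts G = {a, b, c, d, e}" if c5: "c5 ?E a b c d e" for a b c d e
    proof (rule ccontr)
      let ?S = "{a, b, c, d, e}"
      assume "verts G \<noteq> ?S"
      moreover have S: "?S \<subseteq> verts G" using c5 in_V unfolding c5_def by blast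
      ultimately obtain v where v: "v \<in> verts G" "v \<notin> ?S" by blast
      \<comment> \<open>The complement of a 5-hole is a 5-hole on the same set, so \<open>v\<close>
        would have at most two neighbours and at most two non-neighbours among five
        vertices.\<close>
      have "c5 ?C a c e b d"
        using C.c5_compl_adj[of a b c d e] c5 unfolding compl_adj_compl_adj by blast
      then have "c5 (dominates (complement G)) a c e b d" unfolding dominates_complement .
      moreover have "v \<in> verts (complement G)" "v \<notin> {a, c, e, b, d}"
        using v unfolding verts_complement by blast+
      ultimately have "card {x \<in> {a, c, e, b, d}. ?C v x} \<le> 2"
        using c5_rule_of_no_small_wheel[OF GC nw(2)] unfolding dominates_complement_iff by blast
      moreover have "{a, c, e, b, d} = ?S" by blast
      ultimately have "card {x \<in> ?S. ?C v x} \<le> 2" by (simp only:)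
      moreover have "card {x \<in> ?S. ?E v x} \<le> 2"
        using c5_rule_of_no_small_wheel[OF G nw(1) c5] v by blast
      moreover have "?S = {x \<in> ?S. ?E v x} \<union> {x \<in> ?S. ?C v x}"
        using S v by (auto simp: compl_adj_def)
      from arg_cong[OF this, of card] have "card ?S \<le> card {x \<in> ?S. ?E v x} + card {x \<in> ?S. ?C v x}"
        using card_Un_le[of "{x \<in> ?S. ?E v x}" "{x \<in> ?S. ?C v x}"] by linarith
      moreover have "card ?S = 5" using distinct_hole(1)[OF c5] by simp
      ultimately show False by linarith
    qed
    show "verts G = {a, b, c, d, e, f}" if "c6 ?E a b c d e f" for a b c d e f
      by (rule c6_rule_of_no_small_wheel[OF G nw(1) that]) (rule two_k2)
    show "verts G = {a, b, c, d, e, f}" if "co_c6 ?E a b c d e f" for a b c d e f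
    proof -
      have "c6 ?C a b c d e f"
        using C.co_c6_compl_adj[of a b c d e f] that unfolding compl_adj_compl_adj by blast
      then have "c6 (dominates (complement G)) a b c d e f" unfolding dominates_complement .
      then have "verts (complement G) = {a, b, c, d, e, f}"
        by (rule c6_rule_of_no_small_wheel[OF GC nw(2)])
          (rule two_k2_C, unfold dominates_complement dominates_complement_iff verts_complement)
      then show ?thesis unfolding verts_complement .
    qed
  qed
qed

lemma wheel_antiwheel_free_imp_no_wheel:
  assumes G: "graph G" and free: "wheel_antiwheel_free (verts G) (dominates G)" and S: "S \<subseteq> verts G"
  shows "\<not> is_wheel (G \<restriction> S)"
proof
  interpret wheel_antiwheel_free "verts G" "dominates G" by (rule free)
  assume "is_wheel (G \<restriction> S)"
  then obtain h k where h: "h \<in> S" and hole: "is_hole k ((G \<restriction> S) \<restriction> (S - {h}))"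
    and deg: "3 \<le> card {v \<in> S - {h}. h \<rightarrow>\<^bsub>G \<restriction> S\<^esub> v}"
    unfolding is_wheel_def by auto
  define T where "T = S - {h}"
  have T: "T \<subseteq> verts G" "T \<subseteq> S" "h \<notin> T" "h \<in> verts G" using S h unfolding T_def by auto
  have hole: "is_hole k (G \<restriction> T)"
    using hole induce_induce[OF T(2), of G] unfolding T_def by simp
  have "{v \<in> S - {h}. h \<rightarrow>\<^bsub>G \<restriction> S\<^esub> v} = {v \<in> T. h \<rightarrow>\<^bsub>G\<^esub> v}"
    using h unfolding T_def by (auto simp: dominates_induce_iff)
  then have deg: "3 \<le> card {v \<in> T. h \<rightarrow>\<^bsub>G\<^esub> v}" using deg by simp
  note GT = graph_induce[OF G T(1)]
  have "4 \<le> k" using hole unfolding is_hole_def by simp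
  then consider "k = 4" | "k = 5" | "k = 6" | "7 \<le> k" by linarith
  then show False
  proof cases
    case 1
    then obtain a b c d where c4: "c4 (dominates (G \<restriction> T)) a b c d" and T_eq: "T = {a, b, c, d}"
      using hole is_hole_4_iff[OF GT] by auto
    then have c4: "c4 (dominates G) a b c d" by (simp add: c4_def dominates_induce_iff)
    \<comment> \<open>With three neighbours among four vertices at most one vertex is
      missed.\<close>
    have two: "x = y \<or> h \<rightarrow>\<^bsub>G\<^esub> x \<or> h \<rightarrow>\<^bsub>G\<^esub> y" if "x \<in> T" "y \<in> T" for x y
    proof (rule ccontr)
      assume neg: "\<not> ?thesis"
      have "finite T" "card T \<le> 4" using T_eq by (auto simp: card_insert_if)
      then have "card (T - {x, y}) \<le> 2" using neg that by (simp add: card_Diff_subset)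
      moreover have "card {v \<in> T. h \<rightarrow>\<^bsub>G\<^esub> v} \<le> card (T - {x, y})"
        using neg \<open>finite T\<close> by (intro card_mono) auto
      ultimately show False using deg by simp
    qed
    have "c4 (dominates G) b c d a" "c4 (dominates G) c d a b" "c4 (dominates G) d a b c"
      using c4 sym unfolding c4_def by blast+
    moreover have "distinct [a, b, c, d]" using c4 irrefl unfolding c4_def by auto
    ultimately show False
      using c4 c4_rule[of a b c d h] c4_rule[of b c d a h] c4_rule[of c d a b h]
        c4_rule[of d a b c h]
        two[of a b] two[of a c] two[of a d] two[of b c] two[of b d] two[of c d] unfolding T_eq by
          auto
  next
    case 2
    then obtain a b c d e where "c5 (dominates (G \<restriction> T)) a b c d e" and T_eq: "T = {a, b, c, d, e}"
      using hole is_hole_5_iff[OF GT] by auto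
    then have "c5 (dominates G) a b c d e" by (simp add: c5_def dominates_induce_iff)
    from c5_rule[OF this] show False using T T_eq by simp
  next
    case 3
    then obtain a b c d e f where "c6 (dominates (G \<restriction> T)) a b c d e f" and T_eq: "T = {a, b, c, d, e, f}"
      using hole is_hole_6_iff[OF GT] by auto
    then have "c6 (dominates G) a b c d e f" by (simp add: c6_def dominates_induce_iff)
    from c6_rule[OF this] show False using T T_eq by simp
  next
    case 4
    obtain xs where xs: "length xs = k" "distinct xs" "set xs = T"
      and adj': "\<forall>i<k. \<forall>j<k. xs ! i \<rightarrow>\<^bsub>G \<restriction> T\<^esub> xs ! j \<longleftrightarrow> cyclic_adj k i j"
      using hole unfolding is_hole_iff_list by auto
    have adj: "xs ! i \<rightarrow>\<^bsub>G\<^esub> xs ! j \<longleftrightarrow> cyclic_adj k i j" if "i < k" "j < k" for i j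
      using adj' that xs nth_mem[of i xs] nth_mem[of j xs] by (auto simp: dominates_induce_iff)
    have cyc: "cyclic_adj k i j \<longleftrightarrow> j = Suc i \<or> i = Suc j" if "i < k - 1" "j < k - 1" for i j
      using that by (auto simp: cyclic_adj_def)
    \<comment> \<open>For \<open>k = 7\<close> the vertex at index 6 is adjacent to the one at index
      0. Index 0 is therefore put into the last position, the only one about which the 2K2 rule asks
      nothing.\<close>
    have "two_k2 (dominates G) (xs ! 3) (xs ! 4) (xs ! 1) (xs ! 0)"
      using 4 by (simp add: two_k2_def adj cyc)
    moreover have "xs ! 6 \<in> verts G" using 4 xs T nth_mem[of 6 xs] by auto
    moreover have "xs ! 6 \<noteq> xs ! 1" using 4 xs by (simp add: nth_eq_iff_index_eq)
    moreover have "7 mod k = 0 \<or> 7 mod k = 7" using 4 by (cases "k = 7") auto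
    then have "\<not> xs ! 6 \<rightarrow>\<^bsub>G\<^esub> xs ! 3" "\<not> xs ! 6 \<rightarrow>\<^bsub>G\<^esub> xs ! 4" "\<not> xs ! 6 \<rightarrow>\<^bsub>G\<^esub> xs ! 1"
      using 4 by (auto simp: adj cyclic_adj_def mod_Suc)
    ultimately show False by (rule two_k2_rule)
  qed
qed

theorem theorem3:
  fixes G :: "('a,'b) pre_digraph"
  assumes "graph G"
  shows "(free_of (\<lambda>H. is_wheel H \<or> is_antiwheel H) G \<longleftrightarrow>
          free_of (\<lambda>H. card (verts H) \<le> 7 \<and> (is_wheel H \<or> is_antiwheel H)) G)
       \<and> (free_of (\<lambda>H. card (verts H) \<le> 7 \<and> (is_wheel H \<or> is_antiwheel H)) G \<longleftrightarrow>
          basic G \<or> basic (complement G))"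
proof -
  interpret sgraph "verts G" "dominates G" using assms by (rule graph_imp_sgraph)
  note GC = graph_complement[OF assms]
  have wf: "wf_digraph G"
  proof -
    interpret graph G by fact
    show ?thesis by unfold_locales
  qed
  let ?wf = "wheel_antiwheel_free (verts G) (dominates G)"
  let ?F = "\<lambda>H :: ('a, 'b) pre_digraph. is_wheel H \<or> is_antiwheel H"
  \<comment> \<open>Complementation commutes with taking induced subgraphs, so antiwheels of
    \<open>G\<close> are wheels of the complement on the same vertex set.\<close>
  have F: "?F (G \<restriction> S) \<longleftrightarrow> is_wheel (G \<restriction> S) \<or> is_wheel (complement G \<restriction> S)" if "S \<subseteq> verts G" for S
    using that graph_induce[OF assms that] by (simp add: is_antiwheel_def complement_induce)
  have 1: "free_of ?F G" if ?wf
    unfolding free_of_iff[OF wf]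
  proof (intro allI impI)
    fix S assume S: "S \<subseteq> verts G"
    have "wheel_antiwheel_free (verts (complement G)) (dominates (complement G))"
      using wheel_antiwheel_free.wheel_antiwheel_free_compl_adj[OF that] by (simp only: verts_complement dominates_complement)
    moreover have "S \<subseteq> verts (complement G)" using S by (simp only: verts_complement)
    ultimately have "\<not> is_wheel (complement G \<restriction> S)"
      by (rule wheel_antiwheel_free_imp_no_wheel[OF GC])
    then show "\<not> ?F (G \<restriction> S)"
      using F[OF S] wheel_antiwheel_free_imp_no_wheel[OF assms that S] by blast
  qed
  have 2: "free_of (\<lambda>H. card (verts H) \<le> 7 \<and> ?F H) G" if "free_of ?F G"
    using that unfolding free_of_def by blast
  have 3: ?wf if free: "free_of (\<lambda>H. card (verts H) \<le> 7 \<and> ?F H) G"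
  proof (rule wheel_antiwheel_free_of_no_small_wheel[OF assms])
    have "\<not> is_wheel (G \<restriction> S) \<and> \<not> is_wheel (complement G \<restriction> S)" if "S \<subseteq> verts G" "card S \<le> 7" for S
      using free that F[OF that(1)] unfolding free_of_iff[OF wf] by (simp only: induce_subgraph_verts) blast
    then show "no_small_wheel G" "no_small_wheel (complement G)"
      unfolding no_small_wheel_def verts_complement by blast+
  qed
  have "?wf \<longleftrightarrow> basic G \<or> basic (complement G)"
    unfolding wheel_antiwheel_free_iff_adj_basic basic_iff[OF assms] basic_iff[OF GC]
    by (simp only: verts_complement dominates_complement)
  then show ?thesis using 1 2 3 by blast
qed

end
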